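(* For all integers $s\ge 1$ and $p\ge 0$ the following identities of formal series hold (empty sums are $0$): 1. $(2s-1)!\,\mathrm{I}_{2s}^{2p}(q)=\sum_{r=1}^{p}t(2s,2r)\mathrm{D}^{2r-1}A_{2p-2r+1}(q^2)+\sum_{r=p+1}^{s}t(2s,2r)\mathrm{D}^{2p}A_{2r-2p-1}(q^2)$; 2. $(2s)!\,\mathrm{I}_{2s+1}^{2p+1}(q)=\sum_{r=0}^{p}2^{-2r}t(2s+1,2r+1)\mathrm{D}^{2r}C_{2p-2r+1}(q)+\sum_{r=p+1}^{s}2^{-2r}t(2s+1,2r+1)\mathrm{D}^{2p+1}F_{2r-2p-1}(q)$; 3. $(2s-1)!(-1)^{s-1}\mathrm{II}_{2s}^{2p}(q)=\sum_{r=1}^{p}t(2s,2r)\mathrm{D}^{2r-1}L_{2p-2r+1}(q^2)+\sum_{r=p+1}^{s}t(2s,2r)\mathrm{D}^{2p}B_{2r-2p-1}(q^2)$; 4. $(2s)!(-1)^s\mathrm{II}_{2s+1}^{2p}(q)=\sum_{r=0}^{p-1}2^{-2r}t(2s+1,2r+1)\mathrm{D}^{2r}N_{2p-2r}(q)+\sum_{r=p}^{s}2^{-2r}t(2s+1,2r+1)\mathrm{D}^{2p}G_{2r-2p}(q)$; 5. $(2s-1)!\,\mathrm{III}_{2s}^{2p}(q)=\sum_{r=1}^{p}t(2s,2r)\mathrm{D}^{2r-1}F_{2p-2r+1}(q)+\sum_{r=p+1}^{s}t(2s,2r)\mathrm{D}^{2p}C_{2r-2p-1}(q)$; 6. $(2s)!\,\mathrm{III}_{2s+1}^{2p+1}(q)=\sum_{r=0}^{p}t(2s+1,2r+1)\mathrm{D}^{2r}H_{2p-2r+1}(q)+\sum_{r=p+1}^{s}2^{2p+1-2r}t(2s+1,2r+1)\mathrm{D}^{2p+1}H_{2r-2p-1}(q)$;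 7. $(2s-1)!(-1)^{s-1}\mathrm{IV}_{2s}^{2p}(q)=\sum_{r=1}^{p}t(2s,2r)\mathrm{D}^{2r-1}Q_{2p-2r+1}(q)+\sum_{r=p+1}^{s}t(2s,2r)\mathrm{D}^{2p}D_{2r-2p-1}(q)$; 8. $(2s)!(-1)^s\mathrm{IV}_{2s+1}^{2p}(q)=\sum_{r=0}^{p-1}t(2s+1,2r+1)\mathrm{D}^{2r}T_{2p-2r}(q)+\sum_{r=p}^{s}2^{2p-2r}t(2s+1,2r+1)\mathrm{D}^{2p}J_{2r-2p}(q)$; 9. $(2s-1)!\,\mathrm{V}_{2s}^{2p}(q)=\sum_{r=1}^{p}t(2s,2r)\mathrm{D}^{2r-1}B_{2p-2r+1}(q^2)+\sum_{r=p+1}^{s}t(2s,2r)\mathrm{D}^{2p}L_{2r-2p-1}(q^2)$; 10. $(2s)!\,\mathrm{V}_{2s+1}^{2p+1}(q)=\sum_{r=0}^{p}2^{-2r}t(2s+1,2r+1)\mathrm{D}^{2r}D_{2p-2r+1}(q)+\sum_{r=p+1}^{s}2^{-2r}t(2s+1,2r+1)\mathrm{D}^{2p+1}Q_{2r-2p-1}(q)$; 11. $(2s-1)!(-1)^{s-1}\mathrm{VI}_{2s}^{2p}(q)=\sum_{r=1}^{p}t(2s,2r)\mathrm{D}^{2r-1}M_{2p-2r+1}(q^2)+\sum_{r=p+1}^{s}t(2s,2r)\mathrm{D}^{2p}M_{2r-2p-1}(q^2)$; 12. $(2s)!(-1)^s\mathrm{VI}_{2s+1}^{2p}(q)=\sum_{r=0}^{p-1}2^{-2r}t(2s+1,2r+1)\mathrm{D}^{2r}P_{2p-2r}(q)+\sum_{r=p}^{s}2^{-2r}t(2s+1,2r+1)\mathrm{D}^{2p}R_{2r-2p}(q)$;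 13. $(2s-1)!\,\mathrm{VII}_{2s}^{2p+1}(q)=\sum_{r=1}^{p}t(2s,2r)\mathrm{D}^{2r-1}G_{2p-2r+2}(q)+\sum_{r=p+1}^{s}t(2s,2r)\mathrm{D}^{2p+1}N_{2r-2p-2}(q)$; 14. $(2s)!\,\mathrm{VII}_{2s+1}^{2p}(q)=\sum_{r=0}^{p-1}t(2s+1,2r+1)\mathrm{D}^{2r}J_{2p-2r}(q)+\sum_{r=p}^{s}2^{2p-2r}t(2s+1,2r+1)\mathrm{D}^{2p}T_{2r-2p}(q)$; 15. $(2s-1)!(-1)^{s-1}\mathrm{VIII}_{2s}^{2p+1}(q)=\sum_{r=1}^{p}t(2s,2r)\mathrm{D}^{2r-1}R_{2p-2r+2}(q)+\sum_{r=p+1}^{s}t(2s,2r)\mathrm{D}^{2p+1}P_{2r-2p-2}(q)$; 16. $(2s)!(-1)^s\mathrm{VIII}_{2s+1}^{2p+1}(q)=\sum_{r=0}^{p}t(2s+1,2r+1)\mathrm{D}^{2r}U_{2p-2r+1}(q)+\sum_{r=p+1}^{s}2^{2p-2r+1}t(2s+1,2r+1)\mathrm{D}^{2p+1}U_{2r-2p-1}(q)$.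
   Context: All series are formal series in $q^{1/2}$ (equivalently convergent for $0<|q|<1$ with a fixed choice of $q^{1/2}$). For integers $s\ge1$, $p\ge0$ (sums over $n\ge1$): $\mathrm{I}_s^p=\sum\frac{n^pq^{ns}}{(1-q^{2n})^s}$, $\mathrm{II}_s^p=\sum\frac{n^pq^{ns}}{(1+q^{2n})^s}$, $\mathrm{III}_s^p=\sum\frac{(2n-1)^pq^{(n-\frac12)s}}{(1-q^{2n-1})^s}$, $\mathrm{IV}_s^p=\sum\frac{(2n-1)^pq^{(n-\frac12)s}}{(1+q^{2n-1})^s}$, $\mathrm{V}_s^p=\sum\frac{(-1)^{n-1}n^pq^{ns}}{(1-q^{2n})^s}$, $\mathrm{VI}_s^p=\sum\frac{(-1)^{n-1}n^pq^{ns}}{(1+q^{2n})^s}$, $\mathrm{VII}_s^p=\sum\frac{(-1)^{n-1}(2n-1)^pq^{(n-\frac12)s}}{(1-q^{2n-1})^s}$, $\mathrm{VIII}_s^p=\sum\frac{(-1)^{n-1}(2n-1)^pq^{(n-\frac12)s}}{(1+q^{2n-1})^s}$. For integers $s\ge0$ (sums over $n\ge1$): $A_s=\sum\frac{n^sq^n}{1-q^n}$, $B_s=\sum\frac{(-1)^{n-1}n^sq^n}{1-q^n}$, $C_s=\sum\frac{n^sq^n}{1-q^{2n}}$, $D_s=\sum\frac{(-1)^{n-1}n^sq^n}{1-q^{2n}}$, $F_s=\sum\frac{(2n-1)^sq^{2n-1}}{1-q^{2n-1}}$, $G_s=\sum\frac{(-1)^{n-1}(2n-1)^sq^{2n-1}}{1-q^{2n-1}}$,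 $H_s=\sum\frac{(2n-1)^sq^{n-1/2}}{1-q^{2n-1}}$, $J_s=\sum\frac{(-1)^{n-1}(2n-1)^sq^{n-1/2}}{1-q^{2n-1}}$, $L_s=\sum\frac{n^sq^n}{1+q^n}$, $M_s=\sum\frac{(-1)^{n-1}n^sq^n}{1+q^n}$, $N_s=\sum\frac{n^sq^n}{1+q^{2n}}$, $P_s=\sum\frac{(-1)^{n-1}n^sq^n}{1+q^{2n}}$, $Q_s=\sum\frac{(2n-1)^sq^{2n-1}}{1+q^{2n-1}}$, $R_s=\sum\frac{(-1)^{n-1}(2n-1)^sq^{2n-1}}{1+q^{2n-1}}$, $T_s=\sum\frac{(2n-1)^sq^{n-1/2}}{1+q^{2n-1}}$, $U_s=\sum\frac{(-1)^{n-1}(2n-1)^sq^{n-1/2}}{1+q^{2n-1}}$. Central factorial numbers: for $n\ge1$, $x^2\prod_{k=1}^{n-1}(x^2-k^2)=\sum_{k=1}^n t(2n,2k)x^{2k}$; for $n\ge0$, $x\prod_{k=1}^n(x^2-\frac{(2k-1)^2}{4})=\sum_{k=0}^n t(2n+1,2k+1)x^{2k+1}$. The operator $\mathrm{D}$ acts on series $\sum_{\alpha\in\frac12\mathbb{Z}}a_\alpha q^\alpha$ by $\mathrm{D}\sum a_\alpha q^\alpha=\sum\alpha a_\alpha q^\alpha$ (i.e. $q\,d/dq$); $\mathrm{D}^0$ is the identity, and $\mathrm{D}^jF(q^2)$ denotes the series $\mathrm{D}^jF$ with $q$ replaced by $q^2$. *)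

theory Defs
  imports "HOL-Analysis.Analysis" "HOL-Computational_Algebra.Polynomial"
begin

text \<open>Convention: every series is a series in z = q^(1/2); we view it as a function of
  the complex variable z, convergent for 0 < |z| < 1 (all choices of the square root of q
  are covered by letting z range over the punctured unit disc).  Thus q^a = z^(2a).
  Sums over n \<ge> 1 are written as sums over m \<ge> 0 with n = m + 1, so 2n - 1 = 2m + 1
  and (-1)^(n-1) = (-1)^m.\<close>

definition cfact_t :: "nat \<Rightarrow> nat \<Rightarrow> real" where
  "cfact_t m j =
     (if even m then
        coeff ([:0, 0, 1:] * (\<Prod>k\<in>{1..<m div 2}. [:- ((real k)^2), 0, 1:])) j
      else
        coeff ([:0, 1:] * (\<Prod>k\<in>{1..m div 2}. [:- ((real (2*k-1))^2 / 4), 0, 1:])) j)"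

text \<open>The operator D = q d/dq; in the variable z = q^(1/2) it is (z/2) d/dz.\<close>
definition Dop :: "(complex \<Rightarrow> complex) \<Rightarrow> complex \<Rightarrow> complex" where
  "Dop f z = z / 2 * deriv f z"

definition I_ser :: "nat \<Rightarrow> nat \<Rightarrow> complex \<Rightarrow> complex" where
  "I_ser s p z = (\<Sum>m. of_nat (Suc m) ^ p * z ^ (2 * Suc m * s) / (1 - z ^ (4 * Suc m)) ^ s)"
definition II_ser :: "nat \<Rightarrow> nat \<Rightarrow> complex \<Rightarrow> complex" where
  "II_ser s p z = (\<Sum>m. of_nat (Suc m) ^ p * z ^ (2 * Suc m * s) / (1 + z ^ (4 * Suc m)) ^ s)"
definition III_ser :: "nat \<Rightarrow> nat \<Rightarrow> complex \<Rightarrow> complex" where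
  "III_ser s p z = (\<Sum>m. of_nat (2*m+1) ^ p * z ^ ((2*m+1) * s) / (1 - z ^ (2 * (2*m+1))) ^ s)"
definition IV_ser :: "nat \<Rightarrow> nat \<Rightarrow> complex \<Rightarrow> complex" where
  "IV_ser s p z = (\<Sum>m. of_nat (2*m+1) ^ p * z ^ ((2*m+1) * s) / (1 + z ^ (2 * (2*m+1))) ^ s)"
definition V_ser :: "nat \<Rightarrow> nat \<Rightarrow> complex \<Rightarrow> complex" where
  "V_ser s p z = (\<Sum>m. (-1) ^ m * of_nat (Suc m) ^ p * z ^ (2 * Suc m * s) / (1 - z ^ (4 * Suc m)) ^ s)"
definition VI_ser :: "nat \<Rightarrow> nat \<Rightarrow> complex \<Rightarrow> complex" where
  "VI_ser s p z = (\<Sum>m. (-1) ^ m * of_nat (Suc m) ^ p * z ^ (2 * Suc m * s) / (1 + z ^ (4 * Suc m)) ^ s)"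
definition VII_ser :: "nat \<Rightarrow> nat \<Rightarrow> complex \<Rightarrow> complex" where
  "VII_ser s p z = (\<Sum>m. (-1) ^ m * of_nat (2*m+1) ^ p * z ^ ((2*m+1) * s) / (1 - z ^ (2 * (2*m+1))) ^ s)"
definition VIII_ser :: "nat \<Rightarrow> nat \<Rightarrow> complex \<Rightarrow> complex" where
  "VIII_ser s p z = (\<Sum>m. (-1) ^ m * of_nat (2*m+1) ^ p * z ^ ((2*m+1) * s) / (1 + z ^ (2 * (2*m+1))) ^ s)"

definition A_ser :: "nat \<Rightarrow> complex \<Rightarrow> complex" where
  "A_ser s z = (\<Sum>m. of_nat (Suc m) ^ s * z ^ (2 * Suc m) / (1 - z ^ (2 * Suc m)))"
definition B_ser :: "nat \<Rightarrow> complex \<Rightarrow> complex" where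
  "B_ser s z = (\<Sum>m. (-1) ^ m * of_nat (Suc m) ^ s * z ^ (2 * Suc m) / (1 - z ^ (2 * Suc m)))"
definition C_ser :: "nat \<Rightarrow> complex \<Rightarrow> complex" where
  "C_ser s z = (\<Sum>m. of_nat (Suc m) ^ s * z ^ (2 * Suc m) / (1 - z ^ (4 * Suc m)))"
definition D_ser :: "nat \<Rightarrow> complex \<Rightarrow> complex" where
  "D_ser s z = (\<Sum>m. (-1) ^ m * of_nat (Suc m) ^ s * z ^ (2 * Suc m) / (1 - z ^ (4 * Suc m)))"
definition F_ser :: "nat \<Rightarrow> complex \<Rightarrow> complex" where
  "F_ser s z = (\<Sum>m. of_nat (2*m+1) ^ s * z ^ (2 * (2*m+1)) / (1 - z ^ (2 * (2*m+1))))"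
definition G_ser :: "nat \<Rightarrow> complex \<Rightarrow> complex" where
  "G_ser s z = (\<Sum>m. (-1) ^ m * of_nat (2*m+1) ^ s * z ^ (2 * (2*m+1)) / (1 - z ^ (2 * (2*m+1))))"
definition H_ser :: "nat \<Rightarrow> complex \<Rightarrow> complex" where
  "H_ser s z = (\<Sum>m. of_nat (2*m+1) ^ s * z ^ (2*m+1) / (1 - z ^ (2 * (2*m+1))))"
definition J_ser :: "nat \<Rightarrow> complex \<Rightarrow> complex" where
  "J_ser s z = (\<Sum>m. (-1) ^ m * of_nat (2*m+1) ^ s * z ^ (2*m+1) / (1 - z ^ (2 * (2*m+1))))"
definition L_ser :: "nat \<Rightarrow> complex \<Rightarrow> complex" where
  "L_ser s z = (\<Sum>m. of_nat (Suc m) ^ s * z ^ (2 * Suc m) / (1 + z ^ (2 * Suc m)))"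
definition M_ser :: "nat \<Rightarrow> complex \<Rightarrow> complex" where
  "M_ser s z = (\<Sum>m. (-1) ^ m * of_nat (Suc m) ^ s * z ^ (2 * Suc m) / (1 + z ^ (2 * Suc m)))"
definition N_ser :: "nat \<Rightarrow> complex \<Rightarrow> complex" where
  "N_ser s z = (\<Sum>m. of_nat (Suc m) ^ s * z ^ (2 * Suc m) / (1 + z ^ (4 * Suc m)))"
definition P_ser :: "nat \<Rightarrow> complex \<Rightarrow> complex" where
  "P_ser s z = (\<Sum>m. (-1) ^ m * of_nat (Suc m) ^ s * z ^ (2 * Suc m) / (1 + z ^ (4 * Suc m)))"
definition Q_ser :: "nat \<Rightarrow> complex \<Rightarrow> complex" where
  "Q_ser s z = (\<Sum>m. of_nat (2*m+1) ^ s * z ^ (2 * (2*m+1)) / (1 + z ^ (2 * (2*m+1))))"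
definition R_ser :: "nat \<Rightarrow> complex \<Rightarrow> complex" where
  "R_ser s z = (\<Sum>m. (-1) ^ m * of_nat (2*m+1) ^ s * z ^ (2 * (2*m+1)) / (1 + z ^ (2 * (2*m+1))))"
definition T_ser :: "nat \<Rightarrow> complex \<Rightarrow> complex" where
  "T_ser s z = (\<Sum>m. of_nat (2*m+1) ^ s * z ^ (2*m+1) / (1 + z ^ (2 * (2*m+1))))"
definition U_ser :: "nat \<Rightarrow> complex \<Rightarrow> complex" where
  "U_ser s z = (\<Sum>m. (-1) ^ m * of_nat (2*m+1) ^ s * z ^ (2*m+1) / (1 + z ^ (2 * (2*m+1))))"

end

theory Submission
  imports Defs
begin

text \<open>Each of the series is a double series
  $\sum_{n,k\ge1} n^i \alpha(n)\, k^j \beta(k)\, z^{cnk}$ with weights $\alpha,\beta$ that are constant,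
  alternating, the indicator of the odd numbers, or the character modulo 4.  For
  I, ..., VIII this comes from the expansion of $x^s/(1-x)^{2s}$ and
  $x^{2s+1}/(1-x^2)^{2s+1}$, whose coefficients are, up to a factorial, the polynomials
  generating the central factorial numbers.  The operator D raises $i$ and $j$ simultaneously
  by one, so that D to the power $\min(i,j)$ reduces every double series to one with $i = 0$ or
  $j = 0$, and summing over the variable without a power factor gives A, ..., U.\<close>

section \<open>Double Lambert series\<close>

text \<open>The constants have three sources. Since z = q^(1/2), D multiplies z^(c n k) by (c/2) n
  k, so each application costs a factor c/2. This is 1 for c = 2, it produces powers of 2 for c = 1,
  and c = 4 is reduced to c = 2 by passing from z to z^2, which is where the arguments q^2 come
  from. The central factorial numbers of odd order belong to half-integral nodes, so their
  polynomial is evaluated at k/2, which gives 2^(-2r). The signs are those produced by substituting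
  -x or ix. The analytic obstacle is that D acts on functions, whereas the raising of exponents is
  visible on coefficients. The double series is therefore regrouped into a power series in z, on
  which D acts coefficientwise.\<close>

lemma summable_power_mult_power:
  fixes x :: complex
  assumes "norm x < 1"
  shows "summable (\<lambda>n. of_nat n ^ i * x ^ n)"
  using assms
proof (induction i arbitrary: x)
  case 0
  then show ?case by (simp add: summable_geometric)
next
  case (Suc i)
  \<comment> \<open>Applying x d/dx raises the power of n by one, and termwise differentiation does
    not shrink the disc of convergence.\<close>
  have "summable (\<lambda>n. diffs (\<lambda>n. of_nat n ^ i) n * x ^ n)"
    by (rule termdiff_converges[OF Suc.prems]) (rule Suc.IH)
  then have "summable (\<lambda>n. x * (diffs (\<lambda>n. of_nat n ^ i) n * x ^ n))"
    by (rule summable_mult)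
  then have "summable (\<lambda>n. of_nat (Suc n) ^ Suc i * x ^ Suc n)"
    by (simp add: diffs_def mult_ac)
  then show ?case
    by (subst (asm) summable_Suc_iff)
qed

lemma summable_on_power_mult_power:
  fixes \<rho> :: real
  assumes "0 \<le> \<rho>" "\<rho> < 1"
  shows "(\<lambda>n. real n ^ i * \<rho> ^ n) summable_on A"
proof -
  have "summable (\<lambda>n. of_real (real n ^ i * \<rho> ^ n) :: complex)"
    using summable_power_mult_power[of "of_real \<rho>" i] assms by simp
  then have "summable (\<lambda>n. real n ^ i * \<rho> ^ n)"
    by (subst (asm) summable_complex_of_real)
  then have "(\<lambda>n. real n ^ i * \<rho> ^ n) summable_on UNIV"
    using assms by (subst summable_on_UNIV_nonneg_real_iff) auto
  then show ?thesis
    by (rule summable_on_subset_banach) simp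
qed

lemma has_sum_sum:
  fixes f :: "'a \<Rightarrow> 'b \<Rightarrow> 'c :: topological_comm_monoid_add"
  assumes "\<And>r. r \<in> R \<Longrightarrow> (f r has_sum S r) A"
  shows "((\<lambda>x. \<Sum>r\<in>R. f r x) has_sum (\<Sum>r\<in>R. S r)) A"
  using assms by (induction R rule: infinite_finite_induct) (auto intro: has_sum_add)

text \<open>The exponent is counted in z = q^(1/2): \<open>c\<close> = 1, 2, 4 give series in
  q^(nk/2), q^(nk), q^(2nk). Powers and weights are kept apart because D changes only
  \<open>i\<close> and \<open>j\<close>; the unordered sum over pairs allows either index to be
  summed first.\<close>

definition lambert ::
  "nat \<Rightarrow> nat \<Rightarrow> (nat \<Rightarrow> complex) \<Rightarrow> nat \<Rightarrow> (nat \<Rightarrow> complex) \<Rightarrow> complex \<Rightarrow> complex" where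
  "lambert c i \<alpha> j \<beta> z = (\<Sum>\<^sub>\<infinity>(n,k)\<in>{1..}\<times>{1..}.
     (of_nat n ^ i * \<alpha> n) * (of_nat k ^ j * \<beta> k) * z ^ (c * n * k))"

text \<open>The exponent couples n and k, but n + k <= 2nk for n, k >= 1. With \<rho> the square
  root of the norm of z, each power of z is thus at most \<rho>^(n+k) in norm, and the majorant
  splits into a product of two single series.\<close>

lemma lambert_has_sum:
  assumes "norm z < 1" "1 \<le> c" "\<And>n. norm (\<alpha> n) \<le> 1" "\<And>n. norm (\<beta> n) \<le> 1"
  shows "((\<lambda>(n,k). (of_nat n ^ i * \<alpha> n) * (of_nat k ^ j * \<beta> k) * z ^ (c * n * k))
           has_sum lambert c i \<alpha> j \<beta> z) ({1..}\<times>{1..})"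
proof -
  define \<rho> where "\<rho> = sqrt (norm z)"
  have \<rho>: "0 \<le> \<rho>" "\<rho> < 1" "norm z = \<rho>\<^sup>2"
    using assms(1) by (auto simp: \<rho>_def)
  let ?f = "\<lambda>(n,k). (of_nat n ^ i * \<alpha> n) * (of_nat k ^ j * \<beta> k) * z ^ (c * n * k)"
  let ?g = "\<lambda>(n,k). (real n ^ i * \<rho> ^ n) * (real k ^ j * \<rho> ^ k)"
  have "?g summable_on ({1..}\<times>{1..})"
  proof (rule summable_on_SigmaI)
    fix n :: nat
    show "((\<lambda>k. ?g (n, k)) has_sum
            (real n ^ i * \<rho> ^ n) * (\<Sum>\<^sub>\<infinity>k\<in>{1..}. real k ^ j * \<rho> ^ k)) {1..}"
      using has_sum_cmult_right[OF has_sum_infsum[OF summable_on_power_mult_power[OF \<rho>(1,2), of j "{1..}"]], of "real n ^ i * \<rho> ^ n"]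
      by simp
  next
    show "(\<lambda>n. (real n ^ i * \<rho> ^ n) * (\<Sum>\<^sub>\<infinity>k\<in>{1..}. real k ^ j * \<rho> ^ k)) summable_on {1..}"
      by (intro summable_on_cmult_left summable_on_power_mult_power \<rho>)
  qed (use \<rho> in auto)
  moreover have "norm (?f x) \<le> ?g x" if x: "x \<in> {1..}\<times>{1..}" for x
  proof -
    obtain n k where nk: "x = (n,k)" "1 \<le> n" "1 \<le> k" using x by auto
    have "n * 1 \<le> n * k" "1 * k \<le> n * k"
      using nk by (intro mult_mono; simp)+
    then have "n + k \<le> 2 * (1 * (n * k))" by linarith
    also have "\<dots> \<le> 2 * (c * (n * k))"
      using assms(2) by (intro mult_mono) auto
    finally have "norm (z ^ (c * n * k)) \<le> \<rho> ^ (n + k)"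
      using \<rho> by (simp add: norm_power flip: power_mult) (simp add: mult.assoc power_decreasing)
    then have "norm (?f (n,k)) \<le> (real n ^ i * 1) * (real k ^ j * 1) * \<rho> ^ (n + k)"
      unfolding prod.case norm_mult norm_power norm_of_nat
      by (intro mult_mono assms(3,4)) (auto intro!: mult_nonneg_nonneg)
    also have "\<dots> = ?g (n,k)"
      by (simp add: power_add)
    finally show ?thesis
      unfolding nk(1) .
  qed
  ultimately have "(\<lambda>x. norm (?f x)) summable_on ({1..}\<times>{1..})"
    by (rule Infinite_Sum.abs_summable_on_comparison_test')
  then have "?f summable_on ({1..}\<times>{1..})"
    by (rule abs_summable_summable)
  then show ?thesis
    unfolding lambert_def by (rule has_sum_infsum)
qed

lemma lambert_swap: "lambert c i \<alpha> j \<beta> = lambert c j \<beta> i \<alpha>"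
proof
  fix z
  show "lambert c i \<alpha> j \<beta> z = lambert c j \<beta> i \<alpha> z"
    unfolding lambert_def
    by (rule infsum_reindex_bij_witness[of _ prod.swap prod.swap]) (auto simp: mult_ac)
qed

lemma lambert_power: "lambert (c * d) i \<alpha> j \<beta> z = lambert c i \<alpha> j \<beta> (z ^ d)"
  by (simp add: lambert_def mult_ac flip: power_mult)

lemma lambert_iterated_has_sum:
  assumes "norm z < 1" "1 \<le> c" "\<And>n. norm (\<alpha> n) \<le> 1" "\<And>n. norm (\<beta> n) \<le> 1"
  assumes inner: "\<And>x. norm x < 1 \<Longrightarrow>
    ((\<lambda>k. (\<Sum>r\<in>R. t r * of_nat k ^ e r) * \<beta> k * x ^ k) has_sum g x) {1..}"
  shows "((\<lambda>n. of_nat n ^ i * \<alpha> n * g (z ^ (c * n))) has_sum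
           (\<Sum>r\<in>R. t r * lambert c i \<alpha> (e r) \<beta> z)) {1..}"
proof (rule has_sum_SigmaD)
  show "((\<lambda>(n,k). \<Sum>r\<in>R. t r * ((of_nat n ^ i * \<alpha> n) * (of_nat k ^ e r * \<beta> k) * z ^ (c * n * k)))
           has_sum (\<Sum>r\<in>R. t r * lambert c i \<alpha> (e r) \<beta> z)) ({1..}\<times>{1..})"
    unfolding case_prod_unfold
    by (intro has_sum_sum has_sum_cmult_right lambert_has_sum[OF assms(1-4), unfolded case_prod_unfold])
next
  fix n :: nat
  assume "n \<in> {1..}"
  with assms(2) have "c * n \<noteq> 0" by auto
  then have "norm (z ^ (c * n)) < 1"
    using assms(1) by (simp add: norm_power power_less_one_iff)
  from has_sum_cmult_right[OF inner[OF this], of "of_nat n ^ i * \<alpha> n"]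
  show "((\<lambda>k. case (n,k) of (n,k) \<Rightarrow> \<Sum>r\<in>R. t r * ((of_nat n ^ i * \<alpha> n) * (of_nat k ^ e r * \<beta> k) * z ^ (c * n * k)))
          has_sum of_nat n ^ i * \<alpha> n * g (z ^ (c * n))) {1..}"
    by (simp add: sum_distrib_left sum_distrib_right mult_ac flip: power_mult)
qed

lemma has_sum_imp_sums_Suc:
  assumes "(f has_sum S) {1::nat..}"
  shows "(\<lambda>m. f (Suc m)) sums S"
proof -
  have "{1..} = Suc ` UNIV" by (auto simp: image_iff Suc_le_eq gr0_conv_Suc)
  with assms have "(f \<circ> Suc has_sum S) UNIV"
    by (subst has_sum_reindex[symmetric]) auto
  then show ?thesis by (auto dest: has_sum_imp_sums simp: o_def)
qed

lemma has_sum_imp_sums_odd: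
  assumes "(f has_sum S) {1::nat..}" "\<And>n. even n \<Longrightarrow> f n = 0"
  shows "(\<lambda>m. f (2*m+1)) sums S"
proof -
  have "(f has_sum S) (range (\<lambda>m. 2*m+1))"
    using assms by (subst has_sum_cong_neutral[where T="{1..}" and g=f]) (auto simp: image_iff, metis Suc_eq_plus1 oddE)
  then have "(f \<circ> (\<lambda>m. 2*m+1) has_sum S) UNIV"
    by (subst has_sum_reindex[symmetric]) (auto intro: injI)
  then show ?thesis by (auto dest: has_sum_imp_sums simp: o_def)
qed

text \<open>\<open>C\<close> absorbs the factorial and the sign on the left of the identities. Being
  nonzero, it lets convergence of the scaled series give convergence of \<open>a\<close>
  itself.\<close>

lemma lambert_eq_suminf:
  assumes "norm z < 1" "1 \<le> c" "\<And>n. norm (\<alpha> n) \<le> 1" "\<And>n. norm (\<beta> n) \<le> 1"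
  assumes "\<And>x. norm x < 1 \<Longrightarrow>
    ((\<lambda>k. (\<Sum>r\<in>R. t r * of_nat k ^ e r) * \<beta> k * x ^ k) has_sum g x) {1..}"
  assumes "C \<noteq> 0"
    and "\<And>m. C * a m = of_nat (Suc m) ^ i * \<alpha> (Suc m) * g (z ^ (c * Suc m))"
  shows "C * suminf a = (\<Sum>r\<in>R. t r * lambert c i \<alpha> (e r) \<beta> z)"
proof -
  have "(\<lambda>m. C * a m) sums (\<Sum>r\<in>R. t r * lambert c i \<alpha> (e r) \<beta> z)"
    using has_sum_imp_sums_Suc[OF lambert_iterated_has_sum[where g=g and \<alpha>=\<alpha>, OF assms(1-5), of i]] assms(7)
    by simp
  with assms(6) show ?thesis
    using sums_unique sums_mult_D suminf_mult sums_summable by metis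
qed

lemma lambert_eq_suminf_odd:
  assumes "norm z < 1" "1 \<le> c" "\<And>n. norm (\<alpha> n) \<le> 1" "\<And>n. norm (\<beta> n) \<le> 1"
  assumes "\<And>x. norm x < 1 \<Longrightarrow>
    ((\<lambda>k. (\<Sum>r\<in>R. t r * of_nat k ^ e r) * \<beta> k * x ^ k) has_sum g x) {1..}"
  assumes "\<And>n. even n \<Longrightarrow> \<alpha> n = 0" "C \<noteq> 0"
    and "\<And>m. C * a m = of_nat (2*m+1) ^ i * \<alpha> (2*m+1) * g (z ^ (c * (2*m+1)))"
  shows "C * suminf a = (\<Sum>r\<in>R. t r * lambert c i \<alpha> (e r) \<beta> z)"
proof -
  have "(\<lambda>m. C * a m) sums (\<Sum>r\<in>R. t r * lambert c i \<alpha> (e r) \<beta> z)"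
    unfolding assms(8)
    by (rule has_sum_imp_sums_odd[OF lambert_iterated_has_sum[where g=g and \<alpha>=\<alpha>, OF assms(1-5)]])
       (use assms(6) in auto)
  with assms(7) show ?thesis
    using sums_unique sums_mult_D suminf_mult sums_summable by metis
qed

section \<open>The operator D\<close>

lemma Dop_power_series:
  assumes "\<And>z. norm z < 1 \<Longrightarrow> (\<lambda>M. a M * z ^ M) sums f z" "norm z < 1"
  shows "(\<lambda>M. (of_nat M / 2 * a M) * z ^ M) sums Dop f z"
proof -
  have summ: "\<And>z. norm z < 1 \<Longrightarrow> summable (\<lambda>M. a M * z ^ M)"
    using assms(1) sums_summable by blast
  have "((\<lambda>z. \<Sum>M. a M * z ^ M) has_field_derivative (\<Sum>M. diffs a M * z ^ M)) (at z)"
    by (rule termdiffs_strong'[OF summ assms(2)])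
  \<comment> \<open>\<open>f\<close> is known only inside the unit disc; since the disc is open, the
    derivative carries over.\<close>
  then have "(f has_field_derivative (\<Sum>M. diffs a M * z ^ M)) (at z)"
    by (rule has_field_derivative_transform_within_open[where S="ball 0 1"])
       (use assms in \<open>auto simp: sums_iff\<close>)
  then have "Dop f z = z / 2 * (\<Sum>M. diffs a M * z ^ M)"
    unfolding Dop_def by (simp add: DERIV_imp_deriv)
  moreover have "(\<lambda>M. z / 2 * (diffs a M * z ^ M)) sums (z / 2 * (\<Sum>M. diffs a M * z ^ M))"
    by (intro sums_mult summable_sums termdiff_converges[OF assms(2) summ])
  ultimately have "(\<lambda>M. z / 2 * (diffs a M * z ^ M)) sums Dop f z"
    by (simp only:)
  moreover have "z / 2 * (diffs a M * z ^ M) = (of_nat (Suc M) / 2 * a (Suc M)) * z ^ Suc M" for M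
    by (simp add: diffs_def)
  ultimately have "(\<lambda>M. (of_nat (Suc M) / 2 * a (Suc M)) * z ^ Suc M) sums Dop f z"
    by (simp only:)
  \<comment> \<open>The term at M = 0 carries the factor 0, so the index shift does not change the
    sum.\<close>
  then show ?thesis
    by (subst (asm) sums_Suc_iff) simp
qed

lemma funpow_Dop_power_series:
  assumes "\<And>z. norm z < 1 \<Longrightarrow> (\<lambda>M. a M * z ^ M) sums f z" "norm z < 1"
  shows "(\<lambda>M. ((of_nat M / 2) ^ m * a M) * z ^ M) sums (Dop ^^ m) f z"
  using assms(2)
proof (induction m arbitrary: z)
  case 0
  then show ?case using assms(1) by simp
next
  case (Suc m)
  show ?case
    using Dop_power_series[OF Suc.IH Suc.prems] by (simp add: mult_ac)
qed

text \<open>A twisted divisor sum: the coefficient of z^M once all pairs with c n k = M are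
  collected.\<close>

definition lambert_coeff ::
  "nat \<Rightarrow> nat \<Rightarrow> (nat \<Rightarrow> complex) \<Rightarrow> nat \<Rightarrow> (nat \<Rightarrow> complex) \<Rightarrow> nat \<Rightarrow> complex" where
  "lambert_coeff c i \<alpha> j \<beta> M = (\<Sum>(n,k) | 1 \<le> n \<and> 1 \<le> k \<and> c * n * k = M.
     (of_nat n ^ i * \<alpha> n) * (of_nat k ^ j * \<beta> k))"

text \<open>Unconditional convergence permits grouping the pairs by the value of c n k. Each group
  is finite, as c >= 1 bounds n and k by M.\<close>

lemma lambert_power_series:
  assumes "norm z < 1" "1 \<le> c" "\<And>n. norm (\<alpha> n) \<le> 1" "\<And>n. norm (\<beta> n) \<le> 1"
  shows "(\<lambda>M. lambert_coeff c i \<alpha> j \<beta> M * z ^ M) sums lambert c i \<alpha> j \<beta> z"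
proof (rule has_sum_imp_sums, rule has_sum_SigmaD)
  let ?F = "\<lambda>M. {(n,k). 1 \<le> n \<and> 1 \<le> k \<and> c * n * k = M}"
  let ?f = "\<lambda>(n,k). (of_nat n ^ i * \<alpha> n) * (of_nat k ^ j * \<beta> k) * z ^ (c * n * k)"
  have bij: "bij_betw snd (Sigma UNIV ?F) ({1..}\<times>{1..})"
    by (rule bij_betwI[where g="\<lambda>(n,k). (c * n * k, (n,k))"]) auto
  show "((\<lambda>x. ?f (snd x)) has_sum lambert c i \<alpha> j \<beta> z) (Sigma UNIV ?F)"
    by (subst has_sum_reindex_bij_betw[OF bij]) (intro lambert_has_sum assms)
  fix M :: nat
  have "?F M \<subseteq> {..M} \<times> {..M}"
  proof
    fix x assume "x \<in> ?F M"
    then obtain n k where x: "x = (n,k)" "1 \<le> n" "1 \<le> k" "M = c * n * k" by auto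
    have "1 * n * 1 \<le> c * n * k" "1 * 1 * k \<le> c * n * k"
      using x assms(2) by (intro mult_mono; simp)+
    then show "x \<in> {..M} \<times> {..M}" using x by simp
  qed
  then have "finite (?F M)" by (rule finite_subset) simp
  moreover have "(\<Sum>x\<in>?F M. ?f x) = lambert_coeff c i \<alpha> j \<beta> M * z ^ M"
    unfolding lambert_coeff_def sum_distrib_right by (intro sum.cong) auto
  ultimately show "((\<lambda>y. ?f (snd (M, y))) has_sum lambert_coeff c i \<alpha> j \<beta> M * z ^ M) (?F M)"
    by (intro has_sum_finiteI) auto
qed

text \<open>On pairs with c n k = M the factor M^m equals c^m n^m k^m; this is why D raises both
  exponents at once.\<close>

lemma lambert_coeff_add:
  "of_nat c ^ m * lambert_coeff c (i + m) \<alpha> (j + m) \<beta> M = of_nat M ^ m * lambert_coeff c i \<alpha> j \<beta> M"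
  unfolding lambert_coeff_def sum_distrib_left
  by (intro sum.cong) (auto simp: power_add power_mult_distrib mult_ac)

lemma funpow_Dop_lambert:
  assumes "\<And>z. norm z < 1 \<Longrightarrow> f z = lambert c i \<alpha> j \<beta> z"
    and "norm z < 1" "1 \<le> c" "\<And>n. norm (\<alpha> n) \<le> 1" "\<And>n. norm (\<beta> n) \<le> 1"
  shows "(Dop ^^ m) f z = (of_nat c / 2) ^ m * lambert c (i + m) \<alpha> (j + m) \<beta> z"
proof -
  have "(\<lambda>M. ((of_nat M / 2) ^ m * lambert_coeff c i \<alpha> j \<beta> M) * z ^ M) sums (Dop ^^ m) f z"
  proof (rule funpow_Dop_power_series[OF _ assms(2)])
    fix w :: complex
    assume w: "norm w < 1"
    show "(\<lambda>M. lambert_coeff c i \<alpha> j \<beta> M * w ^ M) sums f w"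
      unfolding assms(1)[OF w] by (intro lambert_power_series w assms(3-5))
  qed
  moreover have "(of_nat M / 2) ^ m * lambert_coeff c i \<alpha> j \<beta> M =
      (of_nat c / 2) ^ m * lambert_coeff c (i + m) \<alpha> (j + m) \<beta> M" for M
    using lambert_coeff_add[of c m i \<alpha> j \<beta> M] by (simp add: power_divide)
  ultimately have "(\<lambda>M. ((of_nat c / 2) ^ m * lambert_coeff c (i + m) \<alpha> (j + m) \<beta> M) * z ^ M)
      sums (Dop ^^ m) f z"
    by (simp only:)
  moreover have "(\<lambda>M. (of_nat c / 2) ^ m * (lambert_coeff c (i + m) \<alpha> (j + m) \<beta> M * z ^ M))
      sums ((of_nat c / 2) ^ m * lambert c (i + m) \<alpha> (j + m) \<beta> z)"
    by (intro sums_mult lambert_power_series assms)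
  ultimately show ?thesis
    unfolding mult.assoc by (rule sums_unique2)
qed

section \<open>Generating functions of central factorials\<close>

text \<open>Multiplication by X^2 - a preserves evenness and raises the degree by two, so one
  induction serves both claims.\<close>

lemma prod_quadratic_poly_coeff:
  fixes a :: "nat \<Rightarrow> real"
  assumes "finite K"
  defines "P \<equiv> (\<Prod>k\<in>K. [:- a k, 0, 1:])"
  shows "(odd n \<longrightarrow> coeff P n = 0) \<and> (2 * card K < n \<longrightarrow> coeff P n = 0)"
  unfolding P_def using assms(1)
proof (induction K arbitrary: n rule: finite_induct)
  case empty
  then show ?case by (auto simp: coeff_eq_0 odd_pos)
next
  case (insert k K)
  then show ?case
    by (auto simp: coeff_pCons split: nat.splits)
qed

lemma poly_prod_quadratic:
  fixes a :: "nat \<Rightarrow> real"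
  assumes "finite K"
  defines "P \<equiv> (\<Prod>k\<in>K. [:- a k, 0, 1:])"
  shows "(\<Sum>r\<le>card K. coeff P (2*r) * y ^ (2*r)) = (\<Prod>k\<in>K. y\<^sup>2 - a k)"
proof -
  have odd0: "coeff P n = 0" if "odd n" for n
    using prod_quadratic_poly_coeff[OF assms(1)] that unfolding P_def by blast
  have "degree P \<le> 2 * card K"
    using prod_quadratic_poly_coeff[OF assms(1)] unfolding P_def by (intro degree_le) blast
  then have "poly P y = (\<Sum>i\<le>2 * card K. coeff P i * y ^ i)"
    unfolding poly_altdef
    by (intro sum.mono_neutral_left) (auto simp: coeff_eq_0)
  also have "\<dots> = (\<Sum>i\<in>(\<lambda>r. 2*r) ` {..card K}. coeff P i * y ^ i)"
  proof (intro sum.mono_neutral_right ballI)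
    fix i assume i: "i \<in> {..2 * card K} - (\<lambda>r. 2*r) ` {..card K}"
    have "odd i"
    proof
      assume "even i"
      then obtain r where "i = 2 * r" by (elim evenE)
      with i show False by auto
    qed
    then show "coeff P i * y ^ i = 0" by (simp add: odd0)
  qed auto
  also have "\<dots> = (\<Sum>r\<le>card K. coeff P (2*r) * y ^ (2*r))"
    by (subst sum.reindex) (auto simp: inj_on_def)
  finally show ?thesis
    by (simp add: P_def poly_prod power2_eq_square algebra_simps)
qed

lemma cfact_t_even_Suc:
  assumes "1 \<le> s"
  shows "cfact_t (2 * s) (2*r+2) = coeff (\<Prod>k\<in>{1..<s}. [:- ((real k)\<^sup>2), 0, 1:]) (2*r)"
  unfolding cfact_t_def by (simp add: coeff_pCons)

lemma cfact_t_odd: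
  "cfact_t (2 * s+1) (2*r+1) = coeff (\<Prod>k\<in>{1..s}. [:- ((real (2*k-1))\<^sup>2 / 4), 0, 1:]) (2*r)"
  unfolding cfact_t_def by (simp add: coeff_pCons)

text \<open>Needed when p > s: the sums up to p in the identities then run past s, and the surplus
  terms must vanish.\<close>

lemma cfact_t_even_eq_0:
  assumes "1 \<le> s" "s < r"
  shows "cfact_t (2 * s) (2*r) = 0"
proof -
  obtain r' where r: "r = Suc r'" using assms by (cases r) auto
  have "2 * card {1..<s} < 2 * r'" using assms r by simp
  then have "coeff (\<Prod>k\<in>{1..<s}. [:- ((real k)\<^sup>2), 0, 1:]) (2*r') = 0"
    using prod_quadratic_poly_coeff[of "{1..<s}" "2*r'" "\<lambda>k. (real k)\<^sup>2"] by blast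
  with cfact_t_even_Suc[OF assms(1), of r'] r show ?thesis by simp
qed

lemma cfact_t_odd_eq_0:
  assumes "s < r"
  shows "cfact_t (2 * s+1) (2*r+1) = 0"
proof -
  have "2 * card {1..s} < 2 * r" using assms by simp
  then have "coeff (\<Prod>k\<in>{1..s}. [:- ((real (2*k-1))\<^sup>2 / 4), 0, 1:]) (2*r) = 0"
    using prod_quadratic_poly_coeff[of "{1..s}" "2*r" "\<lambda>k. (real (2*k-1))\<^sup>2 / 4"] by blast
  then show ?thesis by (subst cfact_t_odd)
qed

lemma sum_cfact_t_even:
  assumes "1 \<le> s"
  shows "(\<Sum>r=1..s. cfact_t (2 * s) (2*r) * y ^ (2*r-1)) = y * (\<Prod>k\<in>{1..<s}. y\<^sup>2 - (real k)\<^sup>2)"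
proof -
  have "(\<Sum>r=1..s. cfact_t (2 * s) (2*r) * y ^ (2*r-1)) =
      (\<Sum>r\<le>s-1. cfact_t (2 * s) (2*r+2) * y ^ (2*r+1))"
    using assms
    by (intro sum.reindex_bij_witness[of _ Suc "\<lambda>r. r - 1"])
       (auto simp: Suc_le_eq gr0_conv_Suc)
  also have "\<dots> = y * (\<Sum>r\<le>card {1..<s}. coeff (\<Prod>k\<in>{1..<s}. [:- ((real k)\<^sup>2), 0, 1:]) (2*r) * y ^ (2*r))"
    unfolding cfact_t_even_Suc[OF assms] sum_distrib_left by (simp add: mult_ac)
  also have "\<dots> = y * (\<Prod>k\<in>{1..<s}. y\<^sup>2 - (real k)\<^sup>2)"
    by (subst poly_prod_quadratic) auto
  finally show ?thesis .
qed

lemma sum_cfact_t_odd: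
  "(\<Sum>r=0..s. cfact_t (2 * s+1) (2*r+1) * y ^ (2*r)) = (\<Prod>k\<in>{1..s}. y\<^sup>2 - (real (2*k-1))\<^sup>2 / 4)"
  using poly_prod_quadratic[of "{1..s}" "\<lambda>k. (real (2*k-1))\<^sup>2 / 4" y]
  unfolding cfact_t_odd by (simp add: atMost_atLeast0)

text \<open>The factors y - k and y + k, together with y, form the unbroken run y - s, ..., y + s.
  The induction adds one factor at each end.\<close>

lemma pochhammer_centered_odd_length:
  "pochhammer (y - real s) (2 * s+1) = y * (\<Prod>k\<in>{1..<Suc s}. y\<^sup>2 - (real k)\<^sup>2)"
proof (induction s)
  case (Suc s)
  have "pochhammer (y - real (Suc s)) (2 * Suc s + 1)
      = (y - real (Suc s)) * pochhammer (y - real (Suc s) + 1) (Suc (2 * s+1))"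
    by (simp add: pochhammer_rec)
  also have "\<dots> = (y - real (Suc s)) * (pochhammer (y - real s) (2 * s+1) * (y + real (Suc s)))"
    by (simp add: pochhammer_Suc)
  also have "\<dots> = (y\<^sup>2 - (real (Suc s))\<^sup>2) * pochhammer (y - real s) (2 * s+1)"
    by (simp add: algebra_simps power2_eq_square)
  finally show ?case
    unfolding Suc.IH by (subst prod.atLeastLessThan_Suc) (auto simp: mult_ac)
qed simp

text \<open>The same with half-integral nodes: the run is y - s + 1/2, ..., y + s - 1/2.\<close>

lemma pochhammer_centered_even_length:
  "pochhammer (y - real s + 1/2) (2 * s) = (\<Prod>k\<in>{1..s}. y\<^sup>2 - (real (2*k-1))\<^sup>2 / 4)"
proof (induction s)
  case (Suc s)
  have "pochhammer (y - real (Suc s) + 1/2) (2 * Suc s)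
      = (y - real s - 1/2) * pochhammer (y - real s - 1/2 + 1) (Suc (2 * s))"
    using pochhammer_rec[of "y - real s - 1/2" "Suc (2 * s)"] by (simp add: algebra_simps)
  also have "\<dots> = (y - real s - 1/2) * (pochhammer (y - real s + 1/2) (2 * s) * (y + real s + 1/2))"
    by (simp add: pochhammer_Suc add_ac)
  also have "\<dots> = (y\<^sup>2 - (real (2 * Suc s-1))\<^sup>2 / 4) * pochhammer (y - real s + 1/2) (2 * s)"
    by (simp add: field_simps power2_eq_square)
  finally show ?case
    unfolding Suc.IH by (simp add: mult_ac)
qed simp

section \<open>The negative binomial series\<close>

lemma negative_binomial_has_sum:
  fixes x :: complex
  assumes "norm x < 1"
  shows "((\<lambda>j. of_real (pochhammer (real j + 1) m) * x ^ j) has_sum fact m / (1 - x) ^ (m + 1)) UNIV"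
proof -
  \<comment> \<open>Upper negation gives binomial (m+j, j), and symmetry turns it into binomial
    (m+j, m), a polynomial in j of degree m.\<close>
  have coeff: "(- of_nat (m+1) gchoose j) * (- w) ^ j = of_real (pochhammer (real j + 1) m) / fact m * w ^ j"
    for j and w :: complex
  proof -
    have "(- of_nat (m+1) gchoose j) * (- w) ^ j = (of_nat (m + j) gchoose j) * ((-1) ^ j * (- w) ^ j :: complex)"
      by (subst gbinomial_minus) simp
    also have "(-1) ^ j * (- w) ^ j = w ^ j"
      by (simp flip: power_mult_distrib)
    also have "of_nat (m + j) gchoose j = (of_nat ((m + j) choose m) :: complex)"
      by (metis binomial_gbinomial binomial_symmetric add_diff_cancel_left' le_add1)
    also have "\<dots> = of_nat (m + j) gchoose m"
      by (simp add: binomial_gbinomial)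
    also have "\<dots> = of_real (pochhammer (real j + 1) m) / fact m"
      by (simp add: gbinomial_pochhammer' flip: pochhammer_of_real)
    finally show ?thesis .
  qed
  have sums: "(\<lambda>j. of_real (pochhammer (real j + 1) m) * w ^ j) sums (fact m / (1 - w) ^ (m + 1))"
    if "norm w < 1" for w :: complex
  proof -
    have "w \<noteq> 1" using that by auto
    have "(\<lambda>j. (- of_nat (m+1) gchoose j) * (- w) ^ j) sums (1 + - w) powr (- of_nat (m+1))"
      by (rule gen_binomial_complex) (use that in simp)
    then have "(\<lambda>j. fact m * (of_real (pochhammer (real j + 1) m) / fact m * w ^ j)) sums
        (fact m * (1 - w) powr (- of_nat (m+1)))"
      unfolding coeff by (intro sums_mult) simp
    moreover have "(1 - w) powr (- of_nat (m+1)) = 1 / (1 - w) ^ (m + 1)"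
      using \<open>w \<noteq> 1\<close> by (subst powr_minus, subst powr_nat') (auto simp: field_simps)
    ultimately show ?thesis by simp
  qed
  \<comment> \<open>An unordered sum needs absolute convergence, which at x follows from ordinary
    convergence at a larger radius w < 1.\<close>
  obtain w :: real where w: "norm x < w" "w < 1"
    using dense[OF assms] by blast
  then have "norm (of_real w :: complex) < 1"
    using norm_ge_zero[of x] unfolding norm_of_real by linarith
  from sums_summable[OF sums[OF this]]
  have "summable (\<lambda>j. norm (of_real (pochhammer (real j + 1) m) * x ^ j))"
    by (rule powser_insidea) (use w in simp)
  then show ?thesis
    using sums[OF assms] by (rule norm_summable_imp_has_sum)
qed

section \<open>Weights and their effect on generating functions\<close>

definition one_weight :: "nat \<Rightarrow> complex" where
  "one_weight n = 1"

text \<open>The exponent n + 1 has the parity of n - 1 and avoids truncated subtraction.\<close>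

definition alt_weight :: "nat \<Rightarrow> complex" where
  "alt_weight n = (-1) ^ (n + 1)"

definition odd_weight :: "nat \<Rightarrow> complex" where
  "odd_weight n = (if odd n then 1 else 0)"

text \<open>The non-principal Dirichlet character modulo 4.\<close>

definition chi_weight :: "nat \<Rightarrow> complex" where
  "chi_weight n = (if odd n then (-1) ^ (n div 2) else 0)"

definition weight :: "(nat \<Rightarrow> complex) \<Rightarrow> bool" where
  "weight \<alpha> \<longleftrightarrow> (\<forall>n. norm (\<alpha> n) \<le> 1)"

lemma weightD: "weight \<alpha> \<Longrightarrow> norm (\<alpha> n) \<le> 1"
  by (simp add: weight_def)

lemma weights [simp]: "weight one_weight" "weight alt_weight" "weight odd_weight" "weight chi_weight"
  by (auto simp: weight_def one_weight_def alt_weight_def odd_weight_def chi_weight_def norm_power)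

lemma weight_values:
  "one_weight n = 1"
  "alt_weight (Suc n) = (-1) ^ n"
  "even n \<Longrightarrow> odd_weight n = 0"
  "even n \<Longrightarrow> odd_weight (Suc n) = 1"
  "even n \<Longrightarrow> chi_weight n = 0"
  "even n \<Longrightarrow> chi_weight (Suc n) = (-1) ^ (n div 2)"
  by (auto simp: one_weight_def alt_weight_def odd_weight_def chi_weight_def)

text \<open>Substituting $-x$ for $x$ inserts the alternating weight, substituting $ix$ the character.\<close>

lemma has_sum_alt_weight:
  assumes "\<And>x. norm x < 1 \<Longrightarrow> ((\<lambda>k. H k * x ^ k) has_sum g x) {1..}" "norm x < 1"
  shows "((\<lambda>k. H k * alt_weight k * x ^ k) has_sum - g (- x)) {1..}"
proof -
  have "((\<lambda>k. - (H k * (- x) ^ k)) has_sum - g (- x)) {1..}"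
    using assms by (intro has_sum_uminusI) auto
  moreover have "- (H k * (- x) ^ k) = H k * alt_weight k * x ^ k" for k
    by (simp add: alt_weight_def power_minus[of x])
  ultimately show ?thesis by (simp only:)
qed

lemma has_sum_chi_weight:
  assumes "\<And>x. norm x < 1 \<Longrightarrow> ((\<lambda>k. H k * odd_weight k * x ^ k) has_sum g x) {1..}" "norm x < 1"
  shows "((\<lambda>k. H k * chi_weight k * x ^ k) has_sum - \<i> * g (\<i> * x)) {1..}"
proof -
  have "((\<lambda>k. - \<i> * (H k * odd_weight k * (\<i> * x) ^ k)) has_sum - \<i> * g (\<i> * x)) {1..}"
    using assms by (intro has_sum_cmult_right) (auto simp: norm_mult)
  \<comment> \<open>For k = 2l+1 one has i^k = i (-1)^l; the prefactor -i cancels the remaining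
    i.\<close>
  moreover have "- \<i> * (H k * odd_weight k * (\<i> * x) ^ k) = H k * chi_weight k * x ^ k" for k
    by (auto simp: odd_weight_def chi_weight_def power_mult_distrib mult_ac elim!: oddE)
  ultimately show ?thesis by (simp only:)
qed

text \<open>The coefficient k (k^2 - 1) ... (k^2 - (s-1)^2) vanishes for 1 <= k < s, and at k = j +
  s it is the rising product (j+1) ... (j+2s-1). The series is therefore x^s times a negative
  binomial series.\<close>

lemma has_sum_cfact_even:
  fixes x :: complex
  assumes "1 \<le> s" "norm x < 1"
  shows "((\<lambda>k. (\<Sum>r=1..s. of_real (cfact_t (2 * s) (2*r)) * of_nat k ^ (2*r-1)) * x ^ k)
           has_sum fact (2 * s-1) * x ^ s / (1 - x) ^ (2 * s)) {1..}"
proof -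
  let ?H = "\<lambda>k. (\<Sum>r=1..s. of_real (cfact_t (2 * s) (2*r)) * of_nat k ^ (2*r-1)) :: complex"
  have H: "?H k = of_real (real k * (\<Prod>i\<in>{1..<s}. (real k)\<^sup>2 - (real i)\<^sup>2))" for k
    by (subst sum_cfact_t_even[OF assms(1), symmetric]) simp
  have H_shift: "?H (j + s) = of_real (pochhammer (real j + 1) (2 * s - 1))" for j
    using pochhammer_centered_odd_length[of "real (j + s)" "s - 1"] assms(1)
    unfolding H by (simp add: Suc_diff_Suc numeral_2_eq_2 diff_mult_distrib2)
  have "((\<lambda>j. x ^ s * (of_real (pochhammer (real j + 1) (2 * s - 1)) * x ^ j)) has_sum
          x ^ s * (fact (2 * s-1) / (1 - x) ^ (2 * s-1+1))) UNIV"
    by (intro has_sum_cmult_right negative_binomial_has_sum assms)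
  moreover have "x ^ s * (of_real (pochhammer (real j + 1) (2 * s - 1)) * x ^ j) = ?H (j + s) * x ^ (j + s)" for j
    unfolding H_shift by (simp add: power_add)
  moreover have "x ^ s * (fact (2 * s-1) / (1 - x) ^ (2 * s-1+1)) = fact (2 * s-1) * x ^ s / (1 - x) ^ (2 * s)"
    using assms(1) by simp
  ultimately have "((\<lambda>k. ?H k * x ^ k) \<circ> (\<lambda>j. j + s) has_sum
      fact (2 * s-1) * x ^ s / (1 - x) ^ (2 * s)) UNIV"
    unfolding o_def by (simp only:)
  then have "((\<lambda>k. ?H k * x ^ k) has_sum fact (2 * s-1) * x ^ s / (1 - x) ^ (2 * s)) (range (\<lambda>j. j + s))"
    by (subst has_sum_reindex) (auto simp: inj_on_def)
  also have "?this \<longleftrightarrow> ?thesis"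
  proof (rule has_sum_cong_neutral)
    fix k assume k: "k \<in> {1..} - range (\<lambda>j. j + s)"
    have "k < s"
    proof (rule ccontr)
      assume "\<not> k < s"
      then have "k = (k - s) + s" by simp
      with k show False by blast
    qed
    \<comment> \<open>The factor with i = k is zero.\<close>
    with k have "?H k = 0" unfolding H by (auto intro!: prod_zero)
    then show "?H k * x ^ k = 0" by simp
  qed (use assms(1) in auto)
  finally show ?thesis .
qed

text \<open>The polynomial is taken at y = k/2, whence the powers of 2. It vanishes at the odd k
  below 2s and equals (j+1) ... (j+2s) at k = 2j + 2s + 1, leaving a negative binomial series in
  x^2. At even k it has no zeros, so \<open>odd_weight\<close> is what removes those terms.\<close>

lemma has_sum_cfact_odd:
  fixes x :: complex
  assumes "norm x < 1"
  shows "((\<lambda>k. (\<Sum>r=0..s. of_real (cfact_t (2 * s+1) (2*r+1)) / 2 ^ (2*r) * of_nat k ^ (2*r)) * odd_weight k * x ^ k)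
           has_sum fact (2 * s) * x ^ (2 * s+1) / (1 - x\<^sup>2) ^ (2 * s+1)) {1..}"
proof -
  let ?H = "\<lambda>k. (\<Sum>r=0..s. of_real (cfact_t (2 * s+1) (2*r+1)) / 2 ^ (2*r) * of_nat k ^ (2*r)) :: complex"
  let ?h = "\<lambda>j. 2 * j + (2 * s + 1)"
  have x2: "norm (x\<^sup>2) < 1"
    using assms by (simp add: norm_power power_less_one_iff)
  have H: "?H k = of_real (\<Prod>i\<in>{1..s}. (real k / 2)\<^sup>2 - (real (2*i-1))\<^sup>2 / 4)" for k
    by (subst sum_cfact_t_odd[symmetric]) (simp add: power_divide)
  have H_shift: "?H (?h j) = of_real (pochhammer (real j + 1) (2 * s))" for j
  proof -
    have "real (?h j) / 2 - real s + 1 / 2 = real j + 1" by (simp add: field_simps)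
    then show ?thesis unfolding H pochhammer_centered_even_length[symmetric] by (simp only:)
  qed
  have "((\<lambda>j. x ^ (2 * s+1) * (of_real (pochhammer (real j + 1) (2 * s)) * (x\<^sup>2) ^ j)) has_sum
          x ^ (2 * s+1) * (fact (2 * s) / (1 - x\<^sup>2) ^ (2 * s+1))) UNIV"
    by (intro has_sum_cmult_right negative_binomial_has_sum x2)
  moreover have "x ^ (2 * s+1) * (of_real (pochhammer (real j + 1) (2 * s)) * (x\<^sup>2) ^ j) =
      ?H (?h j) * odd_weight (?h j) * x ^ ?h j" for j
    unfolding H_shift by (simp add: power_add odd_weight_def power_mult)
  moreover have "x ^ (2 * s+1) * (fact (2 * s) / (1 - x\<^sup>2) ^ (2 * s+1)) =
      fact (2 * s) * x ^ (2 * s+1) / (1 - x\<^sup>2) ^ (2 * s+1)"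
    by simp
  ultimately have "((\<lambda>k. ?H k * odd_weight k * x ^ k) \<circ> ?h has_sum
      fact (2 * s) * x ^ (2 * s+1) / (1 - x\<^sup>2) ^ (2 * s+1)) UNIV"
    unfolding o_def by (simp only:)
  then have "((\<lambda>k. ?H k * odd_weight k * x ^ k) has_sum
      fact (2 * s) * x ^ (2 * s+1) / (1 - x\<^sup>2) ^ (2 * s+1)) (range ?h)"
    by (subst has_sum_reindex) (auto simp: inj_on_def)
  also have "?this \<longleftrightarrow> ?thesis"
  proof (rule has_sum_cong_neutral)
    fix k assume k: "k \<in> {1..} - range ?h"
    show "?H k * odd_weight k * x ^ k = 0"
    proof (cases "odd k")
      case True
      then obtain i where i: "k = 2 * i + 1" by (auto elim: oddE)
      have "i < s"
      proof (rule ccontr)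
        assume "\<not> i < s"
        then have "k = ?h (i - s)" using i by simp
        with k show False by blast
      qed
      \<comment> \<open>For k = 2i + 1 the vanishing factor has index i + 1, as 2(i+1) - 1 =
        k.\<close>
      then have "?H k = 0" unfolding H i
        by (intro iffD2[OF of_real_eq_0_iff] prod_zero bexI[of _ "Suc i"])
           (auto simp: power2_eq_square field_simps)
      then show ?thesis by simp
    qed (simp add: odd_weight_def)
  qed auto
  finally show ?thesis .
qed

lemma has_sum_odd_weight:
  fixes x :: complex
  assumes "norm x < 1"
  shows "((\<lambda>k. odd_weight k * x ^ k) has_sum x / (1 - x\<^sup>2)) {1..}"
  using has_sum_cfact_odd[OF assms, of 0] by (simp add: cfact_t_def)

lemma has_sum_cfact_even_one:
  assumes "1 \<le> s" "norm x < 1"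
  shows "((\<lambda>k. (\<Sum>r=1..s. of_real (cfact_t (2 * s) (2*r)) * of_nat k ^ (2*r-1)) * one_weight k * x ^ k)
           has_sum fact (2 * s-1) * x ^ s / (1 - x) ^ (2 * s)) {1..}"
  using has_sum_cfact_even[OF assms] by (simp add: one_weight_def)

text \<open>The sign is that of -(-x)^s; it is the origin of (-1)^(s-1) in the identities for II,
  IV, VI and VIII of even order.\<close>

lemma has_sum_cfact_even_alt:
  assumes "1 \<le> s" "norm x < 1"
  shows "((\<lambda>k. (\<Sum>r=1..s. of_real (cfact_t (2 * s) (2*r)) * of_nat k ^ (2*r-1)) * alt_weight k * x ^ k)
           has_sum fact (2 * s-1) * (-1) ^ (s-1) * x ^ s / (1 + x) ^ (2 * s)) {1..}"
proof -
  have "- (fact (2 * s-1) * (- x) ^ s / (1 - - x) ^ (2 * s)) =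
      fact (2 * s-1) * (-1) ^ (s-1) * x ^ s / (1 + x) ^ (2 * s)"
    using assms(1) by (cases s) (auto simp: power_minus[of x])
  with has_sum_alt_weight[OF has_sum_cfact_even[OF assms(1)] assms(2)] show ?thesis
    by (simp only:)
qed

text \<open>Here -i (ix)^(2s+1) = (-1)^s x^(2s+1), which explains the sign (-1)^s in odd
  order.\<close>

lemma has_sum_cfact_odd_chi:
  assumes "norm x < 1"
  shows "((\<lambda>k. (\<Sum>r=0..s. of_real (cfact_t (2 * s+1) (2*r+1)) / 2 ^ (2*r) * of_nat k ^ (2*r)) * chi_weight k * x ^ k)
           has_sum fact (2 * s) * (-1) ^ s * x ^ (2 * s+1) / (1 + x\<^sup>2) ^ (2 * s+1)) {1..}"
proof -
  have "- \<i> * (fact (2 * s) * (\<i> * x) ^ (2 * s+1) / (1 - (\<i> * x)\<^sup>2) ^ (2 * s+1)) =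
      fact (2 * s) * (-1) ^ s * x ^ (2 * s+1) / (1 + x\<^sup>2) ^ (2 * s+1)"
    by (simp add: power_mult_distrib mult_ac)
  with has_sum_chi_weight[OF has_sum_cfact_odd assms, of s] show ?thesis
    by (simp only:)
qed

section \<open>The single and double series as Lambert series\<close>

text \<open>The index of the family is the power of n, and k carries no power, so that the sum over
  k is an elementary fraction.\<close>

definition lambert_family ::
  "nat \<Rightarrow> (nat \<Rightarrow> complex) \<Rightarrow> (nat \<Rightarrow> complex) \<Rightarrow> (nat \<Rightarrow> complex \<Rightarrow> complex) \<Rightarrow> bool" where
  "lambert_family c \<alpha> \<beta> X \<longleftrightarrow> (\<forall>e z. norm z < 1 \<longrightarrow> X e z = lambert c e \<alpha> 0 \<beta> z)"

lemma has_sum_one_weight: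
  fixes x :: complex
  assumes "norm x < 1"
  shows "((\<lambda>k. one_weight k * x ^ k) has_sum x / (1 - x)) {1..}"
  using has_sum_geometric_from_1[OF assms] by (simp add: one_weight_def)

lemma has_sum_alt_weight_simple:
  fixes x :: complex
  assumes "norm x < 1"
  shows "((\<lambda>k. alt_weight k * x ^ k) has_sum x / (1 + x)) {1..}"
  using has_sum_alt_weight[where H="\<lambda>_. 1" and g="\<lambda>x. x / (1 - x)", OF _ assms] has_sum_one_weight
  by (simp add: one_weight_def)

lemma has_sum_chi_weight_simple:
  fixes x :: complex
  assumes "norm x < 1"
  shows "((\<lambda>k. chi_weight k * x ^ k) has_sum x / (1 + x\<^sup>2)) {1..}"
  using has_sum_chi_weight[where H="\<lambda>_. 1" and g="\<lambda>x. x / (1 - x\<^sup>2)", OF _ assms] has_sum_odd_weight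
  by (simp add: power_mult_distrib)

text \<open>With no power of k the inner polynomial is the constant 1: the one-term case of
  \<open>lambert_eq_suminf\<close>.\<close>

lemma lambert_family_all:
  assumes "1 \<le> c" "weight \<alpha>" "weight \<beta>"
    and "\<And>x. norm x < 1 \<Longrightarrow> ((\<lambda>k. \<beta> k * x ^ k) has_sum g x) {1..}"
    and "\<And>i z. X i z = (\<Sum>m. of_nat (Suc m) ^ i * \<alpha> (Suc m) * g (z ^ (c * Suc m)))"
  shows "lambert_family c \<alpha> \<beta> X"
  unfolding lambert_family_def
proof (intro allI impI)
  fix i and z :: complex
  assume "norm z < 1"
  then show "X i z = lambert c i \<alpha> 0 \<beta> z"
    using lambert_eq_suminf[where R="{0::nat}" and t="\<lambda>_. 1" and e="\<lambda>_. 0" and C=1 and g=g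
        and \<alpha>=\<alpha> and \<beta>=\<beta> and c=c and i=i and z=z
        and a="\<lambda>m. of_nat (Suc m) ^ i * \<alpha> (Suc m) * g (z ^ (c * Suc m))"]
      assms(1,4) weightD[OF assms(2)] weightD[OF assms(3)]
    unfolding assms(5) by simp
qed

lemma lambert_family_odd:
  assumes "1 \<le> c" "weight \<alpha>" "weight \<beta>" "\<And>n. even n \<Longrightarrow> \<alpha> n = 0"
    and "\<And>x. norm x < 1 \<Longrightarrow> ((\<lambda>k. \<beta> k * x ^ k) has_sum g x) {1..}"
    and "\<And>i z. X i z = (\<Sum>m. of_nat (2*m+1) ^ i * \<alpha> (2*m+1) * g (z ^ (c * (2*m+1))))"
  shows "lambert_family c \<alpha> \<beta> X"
  unfolding lambert_family_def
proof (intro allI impI)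
  fix i and z :: complex
  assume "norm z < 1"
  then show "X i z = lambert c i \<alpha> 0 \<beta> z"
    using lambert_eq_suminf_odd[where R="{0::nat}" and t="\<lambda>_. 1" and e="\<lambda>_. 0" and C=1 and g=g
        and \<alpha>=\<alpha> and \<beta>=\<beta> and c=c and i=i and z=z
        and a="\<lambda>m. of_nat (2*m+1) ^ i * \<alpha> (2*m+1) * g (z ^ (c * (2*m+1)))"]
      assms(1,4,5) weightD[OF assms(2)] weightD[OF assms(3)]
    unfolding assms(6) by simp
qed

text \<open>The first weight is read off from the range and sign of n. The second comes from the
  fraction: x/(1-x), x/(1+x), x/(1-x^2), x/(1+x^2) belong to the constant, alternating, odd and
  character weights. The numerator x = z^(c n) determines \<open>c\<close>.\<close>

lemma lambert_families:
  shows "lambert_family 2 one_weight one_weight A_ser"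
    and "lambert_family 2 alt_weight one_weight B_ser"
    and "lambert_family 2 one_weight odd_weight C_ser"
    and "lambert_family 2 alt_weight odd_weight D_ser"
    and "lambert_family 2 odd_weight one_weight F_ser"
    and "lambert_family 2 chi_weight one_weight G_ser"
    and "lambert_family 1 odd_weight odd_weight H_ser"
    and "lambert_family 1 chi_weight odd_weight J_ser"
    and "lambert_family 2 one_weight alt_weight L_ser"
    and "lambert_family 2 alt_weight alt_weight M_ser"
    and "lambert_family 2 one_weight chi_weight N_ser"
    and "lambert_family 2 alt_weight chi_weight P_ser"
    and "lambert_family 2 odd_weight alt_weight Q_ser"
    and "lambert_family 2 chi_weight alt_weight R_ser"
    and "lambert_family 1 odd_weight chi_weight T_ser"
    and "lambert_family 1 chi_weight chi_weight U_ser"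
proof -
  show "lambert_family 2 one_weight one_weight A_ser"
    by (rule lambert_family_all[OF _ weights(1) weights(1) has_sum_one_weight])
       (simp_all add: A_ser_def weight_values mult_ac nat_mult_1[unfolded One_nat_def]
          del: mult_Suc mult_Suc_right of_nat_Suc power_Suc flip: power_mult)
  show "lambert_family 2 alt_weight one_weight B_ser"
    by (rule lambert_family_all[OF _ weights(2) weights(1) has_sum_one_weight])
       (simp_all add: B_ser_def weight_values mult_ac nat_mult_1[unfolded One_nat_def]
          del: mult_Suc mult_Suc_right of_nat_Suc power_Suc flip: power_mult)
  show "lambert_family 2 one_weight odd_weight C_ser"
    by (rule lambert_family_all[OF _ weights(1) weights(3) has_sum_odd_weight])
       (simp_all add: C_ser_def weight_values mult_ac nat_mult_1[unfolded One_nat_def]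
          del: mult_Suc mult_Suc_right of_nat_Suc power_Suc flip: power_mult)
  show "lambert_family 2 alt_weight odd_weight D_ser"
    by (rule lambert_family_all[OF _ weights(2) weights(3) has_sum_odd_weight])
       (simp_all add: D_ser_def weight_values mult_ac nat_mult_1[unfolded One_nat_def]
          del: mult_Suc mult_Suc_right of_nat_Suc power_Suc flip: power_mult)
  show "lambert_family 2 odd_weight one_weight F_ser"
    by (rule lambert_family_odd[OF _ weights(3) weights(1) _ has_sum_one_weight])
       (simp_all add: F_ser_def weight_values mult_ac nat_mult_1[unfolded One_nat_def]
          del: mult_Suc mult_Suc_right of_nat_Suc power_Suc flip: power_mult)
  show "lambert_family 2 chi_weight one_weight G_ser"
    by (rule lambert_family_odd[OF _ weights(4) weights(1) _ has_sum_one_weight])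
       (simp_all add: G_ser_def weight_values mult_ac nat_mult_1[unfolded One_nat_def]
          del: mult_Suc mult_Suc_right of_nat_Suc power_Suc flip: power_mult)
  show "lambert_family 1 odd_weight odd_weight H_ser"
    by (rule lambert_family_odd[OF _ weights(3) weights(3) _ has_sum_odd_weight])
       (simp_all add: H_ser_def weight_values mult_ac nat_mult_1[unfolded One_nat_def]
          del: mult_Suc mult_Suc_right of_nat_Suc power_Suc flip: power_mult)
  show "lambert_family 1 chi_weight odd_weight J_ser"
    by (rule lambert_family_odd[OF _ weights(4) weights(3) _ has_sum_odd_weight])
       (simp_all add: J_ser_def weight_values mult_ac nat_mult_1[unfolded One_nat_def]
          del: mult_Suc mult_Suc_right of_nat_Suc power_Suc flip: power_mult)
  show "lambert_family 2 one_weight alt_weight L_ser"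
    by (rule lambert_family_all[OF _ weights(1) weights(2) has_sum_alt_weight_simple])
       (simp_all add: L_ser_def weight_values mult_ac nat_mult_1[unfolded One_nat_def]
          del: mult_Suc mult_Suc_right of_nat_Suc power_Suc flip: power_mult)
  show "lambert_family 2 alt_weight alt_weight M_ser"
    by (rule lambert_family_all[OF _ weights(2) weights(2) has_sum_alt_weight_simple])
       (simp_all add: M_ser_def weight_values mult_ac nat_mult_1[unfolded One_nat_def]
          del: mult_Suc mult_Suc_right of_nat_Suc power_Suc flip: power_mult)
  show "lambert_family 2 one_weight chi_weight N_ser"
    by (rule lambert_family_all[OF _ weights(1) weights(4) has_sum_chi_weight_simple])
       (simp_all add: N_ser_def weight_values mult_ac nat_mult_1[unfolded One_nat_def]
          del: mult_Suc mult_Suc_right of_nat_Suc power_Suc flip: power_mult)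
  show "lambert_family 2 alt_weight chi_weight P_ser"
    by (rule lambert_family_all[OF _ weights(2) weights(4) has_sum_chi_weight_simple])
       (simp_all add: P_ser_def weight_values mult_ac nat_mult_1[unfolded One_nat_def]
          del: mult_Suc mult_Suc_right of_nat_Suc power_Suc flip: power_mult)
  show "lambert_family 2 odd_weight alt_weight Q_ser"
    by (rule lambert_family_odd[OF _ weights(3) weights(2) _ has_sum_alt_weight_simple])
       (simp_all add: Q_ser_def weight_values mult_ac nat_mult_1[unfolded One_nat_def]
          del: mult_Suc mult_Suc_right of_nat_Suc power_Suc flip: power_mult)
  show "lambert_family 2 chi_weight alt_weight R_ser"
    by (rule lambert_family_odd[OF _ weights(4) weights(2) _ has_sum_alt_weight_simple])
       (simp_all add: R_ser_def weight_values mult_ac nat_mult_1[unfolded One_nat_def]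
          del: mult_Suc mult_Suc_right of_nat_Suc power_Suc flip: power_mult)
  show "lambert_family 1 odd_weight chi_weight T_ser"
    by (rule lambert_family_odd[OF _ weights(3) weights(4) _ has_sum_chi_weight_simple])
       (simp_all add: T_ser_def weight_values mult_ac nat_mult_1[unfolded One_nat_def]
          del: mult_Suc mult_Suc_right of_nat_Suc power_Suc flip: power_mult)
  show "lambert_family 1 chi_weight chi_weight U_ser"
    by (rule lambert_family_odd[OF _ weights(4) weights(4) _ has_sum_chi_weight_simple])
       (simp_all add: U_ser_def weight_values mult_ac nat_mult_1[unfolded One_nat_def]
          del: mult_Suc mult_Suc_right of_nat_Suc power_Suc flip: power_mult)
qed

text \<open>In even order the summands contain x^s/(1-x)^(2s) or x^s/(1+x)^(2s), with x = z^(4n)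
  when n runs over all positive integers and x = z^(2n) when it runs over the odd ones.\<close>

lemma even_series_eq_lambert:
  fixes z :: complex
  assumes "1 \<le> s" "norm z < 1"
  shows "fact (2 * s-1) * I_ser (2 * s) P z =
      (\<Sum>r=1..s. of_real (cfact_t (2 * s) (2*r)) * lambert 4 P one_weight (2*r-1) one_weight z)"
    and "fact (2 * s-1) * (-1) ^ (s-1) * II_ser (2 * s) P z =
      (\<Sum>r=1..s. of_real (cfact_t (2 * s) (2*r)) * lambert 4 P one_weight (2*r-1) alt_weight z)"
    and "fact (2 * s-1) * III_ser (2 * s) P z =
      (\<Sum>r=1..s. of_real (cfact_t (2 * s) (2*r)) * lambert 2 P odd_weight (2*r-1) one_weight z)"
    and "fact (2 * s-1) * (-1) ^ (s-1) * IV_ser (2 * s) P z =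
      (\<Sum>r=1..s. of_real (cfact_t (2 * s) (2*r)) * lambert 2 P odd_weight (2*r-1) alt_weight z)"
    and "fact (2 * s-1) * V_ser (2 * s) P z =
      (\<Sum>r=1..s. of_real (cfact_t (2 * s) (2*r)) * lambert 4 P alt_weight (2*r-1) one_weight z)"
    and "fact (2 * s-1) * (-1) ^ (s-1) * VI_ser (2 * s) P z =
      (\<Sum>r=1..s. of_real (cfact_t (2 * s) (2*r)) * lambert 4 P alt_weight (2*r-1) alt_weight z)"
    and "fact (2 * s-1) * VII_ser (2 * s) P z =
      (\<Sum>r=1..s. of_real (cfact_t (2 * s) (2*r)) * lambert 2 P chi_weight (2*r-1) one_weight z)"
    and "fact (2 * s-1) * (-1) ^ (s-1) * VIII_ser (2 * s) P z =
      (\<Sum>r=1..s. of_real (cfact_t (2 * s) (2*r)) * lambert 2 P chi_weight (2*r-1) alt_weight z)"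
proof -
  show "fact (2 * s-1) * I_ser (2 * s) P z =
      (\<Sum>r=1..s. of_real (cfact_t (2 * s) (2*r)) * lambert 4 P one_weight (2*r-1) one_weight z)"
    unfolding I_ser_def
    by (rule lambert_eq_suminf[OF assms(2) _ _ _ has_sum_cfact_even_one[OF assms(1)]])
       (simp_all add: weightD weight_values mult_ac nat_mult_1[unfolded One_nat_def]
          del: mult_Suc mult_Suc_right of_nat_Suc power_Suc flip: power_mult)
  show "fact (2 * s-1) * (-1) ^ (s-1) * II_ser (2 * s) P z =
      (\<Sum>r=1..s. of_real (cfact_t (2 * s) (2*r)) * lambert 4 P one_weight (2*r-1) alt_weight z)"
    unfolding II_ser_def
    by (rule lambert_eq_suminf[OF assms(2) _ _ _ has_sum_cfact_even_alt[OF assms(1)]])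
       (simp_all add: weightD weight_values mult_ac nat_mult_1[unfolded One_nat_def]
          del: mult_Suc mult_Suc_right of_nat_Suc power_Suc flip: power_mult)
  show "fact (2 * s-1) * III_ser (2 * s) P z =
      (\<Sum>r=1..s. of_real (cfact_t (2 * s) (2*r)) * lambert 2 P odd_weight (2*r-1) one_weight z)"
    unfolding III_ser_def
    by (rule lambert_eq_suminf_odd[OF assms(2) _ _ _ has_sum_cfact_even_one[OF assms(1)]])
       (simp_all add: weightD weight_values mult_ac nat_mult_1[unfolded One_nat_def]
          del: mult_Suc mult_Suc_right of_nat_Suc power_Suc flip: power_mult)
  show "fact (2 * s-1) * (-1) ^ (s-1) * IV_ser (2 * s) P z =
      (\<Sum>r=1..s. of_real (cfact_t (2 * s) (2*r)) * lambert 2 P odd_weight (2*r-1) alt_weight z)"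
    unfolding IV_ser_def
    by (rule lambert_eq_suminf_odd[OF assms(2) _ _ _ has_sum_cfact_even_alt[OF assms(1)]])
       (simp_all add: weightD weight_values mult_ac nat_mult_1[unfolded One_nat_def]
          del: mult_Suc mult_Suc_right of_nat_Suc power_Suc flip: power_mult)
  show "fact (2 * s-1) * V_ser (2 * s) P z =
      (\<Sum>r=1..s. of_real (cfact_t (2 * s) (2*r)) * lambert 4 P alt_weight (2*r-1) one_weight z)"
    unfolding V_ser_def
    by (rule lambert_eq_suminf[OF assms(2) _ _ _ has_sum_cfact_even_one[OF assms(1)]])
       (simp_all add: weightD weight_values mult_ac nat_mult_1[unfolded One_nat_def]
          del: mult_Suc mult_Suc_right of_nat_Suc power_Suc flip: power_mult)
  show "fact (2 * s-1) * (-1) ^ (s-1) * VI_ser (2 * s) P z =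
      (\<Sum>r=1..s. of_real (cfact_t (2 * s) (2*r)) * lambert 4 P alt_weight (2*r-1) alt_weight z)"
    unfolding VI_ser_def
    by (rule lambert_eq_suminf[OF assms(2) _ _ _ has_sum_cfact_even_alt[OF assms(1)]])
       (simp_all add: weightD weight_values mult_ac nat_mult_1[unfolded One_nat_def]
          del: mult_Suc mult_Suc_right of_nat_Suc power_Suc flip: power_mult)
  show "fact (2 * s-1) * VII_ser (2 * s) P z =
      (\<Sum>r=1..s. of_real (cfact_t (2 * s) (2*r)) * lambert 2 P chi_weight (2*r-1) one_weight z)"
    unfolding VII_ser_def
    by (rule lambert_eq_suminf_odd[OF assms(2) _ _ _ has_sum_cfact_even_one[OF assms(1)]])
       (simp_all add: weightD weight_values mult_ac nat_mult_1[unfolded One_nat_def]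
          del: mult_Suc mult_Suc_right of_nat_Suc power_Suc flip: power_mult)
  show "fact (2 * s-1) * (-1) ^ (s-1) * VIII_ser (2 * s) P z =
      (\<Sum>r=1..s. of_real (cfact_t (2 * s) (2*r)) * lambert 2 P chi_weight (2*r-1) alt_weight z)"
    unfolding VIII_ser_def
    by (rule lambert_eq_suminf_odd[OF assms(2) _ _ _ has_sum_cfact_even_alt[OF assms(1)]])
       (simp_all add: weightD weight_values mult_ac nat_mult_1[unfolded One_nat_def]
          del: mult_Suc mult_Suc_right of_nat_Suc power_Suc flip: power_mult)
qed

text \<open>In odd order the numerator has no integral power of the previous x, so x is replaced by
  its square root z^(2n) or z^n and the denominator involves x^2. This halves
  \<open>c\<close>.\<close>

lemma odd_series_eq_lambert:
  fixes z :: complex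
  assumes "norm z < 1"
  shows "fact (2 * s) * I_ser (2 * s+1) P z =
      (\<Sum>r=0..s. of_real (cfact_t (2 * s+1) (2*r+1)) / 2 ^ (2*r) * lambert 2 P one_weight (2*r) odd_weight z)"
    and "fact (2 * s) * (-1) ^ s * II_ser (2 * s+1) P z =
      (\<Sum>r=0..s. of_real (cfact_t (2 * s+1) (2*r+1)) / 2 ^ (2*r) * lambert 2 P one_weight (2*r) chi_weight z)"
    and "fact (2 * s) * III_ser (2 * s+1) P z =
      (\<Sum>r=0..s. of_real (cfact_t (2 * s+1) (2*r+1)) / 2 ^ (2*r) * lambert 1 P odd_weight (2*r) odd_weight z)"
    and "fact (2 * s) * (-1) ^ s * IV_ser (2 * s+1) P z =
      (\<Sum>r=0..s. of_real (cfact_t (2 * s+1) (2*r+1)) / 2 ^ (2*r) * lambert 1 P odd_weight (2*r) chi_weight z)"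
    and "fact (2 * s) * V_ser (2 * s+1) P z =
      (\<Sum>r=0..s. of_real (cfact_t (2 * s+1) (2*r+1)) / 2 ^ (2*r) * lambert 2 P alt_weight (2*r) odd_weight z)"
    and "fact (2 * s) * (-1) ^ s * VI_ser (2 * s+1) P z =
      (\<Sum>r=0..s. of_real (cfact_t (2 * s+1) (2*r+1)) / 2 ^ (2*r) * lambert 2 P alt_weight (2*r) chi_weight z)"
    and "fact (2 * s) * VII_ser (2 * s+1) P z =
      (\<Sum>r=0..s. of_real (cfact_t (2 * s+1) (2*r+1)) / 2 ^ (2*r) * lambert 1 P chi_weight (2*r) odd_weight z)"
    and "fact (2 * s) * (-1) ^ s * VIII_ser (2 * s+1) P z =
      (\<Sum>r=0..s. of_real (cfact_t (2 * s+1) (2*r+1)) / 2 ^ (2*r) * lambert 1 P chi_weight (2*r) chi_weight z)"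
proof -
  show "fact (2 * s) * I_ser (2 * s+1) P z =
      (\<Sum>r=0..s. of_real (cfact_t (2 * s+1) (2*r+1)) / 2 ^ (2*r) * lambert 2 P one_weight (2*r) odd_weight z)"
    unfolding I_ser_def
    by (rule lambert_eq_suminf[OF assms _ _ _ has_sum_cfact_odd])
       (simp_all add: weightD weight_values mult_ac nat_mult_1[unfolded One_nat_def]
          del: mult_Suc mult_Suc_right of_nat_Suc power_Suc flip: power_mult)
  show "fact (2 * s) * (-1) ^ s * II_ser (2 * s+1) P z =
      (\<Sum>r=0..s. of_real (cfact_t (2 * s+1) (2*r+1)) / 2 ^ (2*r) * lambert 2 P one_weight (2*r) chi_weight z)"
    unfolding II_ser_def
    by (rule lambert_eq_suminf[OF assms _ _ _ has_sum_cfact_odd_chi])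
       (simp_all add: weightD weight_values mult_ac nat_mult_1[unfolded One_nat_def]
          del: mult_Suc mult_Suc_right of_nat_Suc power_Suc flip: power_mult)
  show "fact (2 * s) * III_ser (2 * s+1) P z =
      (\<Sum>r=0..s. of_real (cfact_t (2 * s+1) (2*r+1)) / 2 ^ (2*r) * lambert 1 P odd_weight (2*r) odd_weight z)"
    unfolding III_ser_def
    by (rule lambert_eq_suminf_odd[OF assms _ _ _ has_sum_cfact_odd])
       (simp_all add: weightD weight_values mult_ac nat_mult_1[unfolded One_nat_def]
          del: mult_Suc mult_Suc_right of_nat_Suc power_Suc flip: power_mult)
  show "fact (2 * s) * (-1) ^ s * IV_ser (2 * s+1) P z =
      (\<Sum>r=0..s. of_real (cfact_t (2 * s+1) (2*r+1)) / 2 ^ (2*r) * lambert 1 P odd_weight (2*r) chi_weight z)"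
    unfolding IV_ser_def
    by (rule lambert_eq_suminf_odd[OF assms _ _ _ has_sum_cfact_odd_chi])
       (simp_all add: weightD weight_values mult_ac nat_mult_1[unfolded One_nat_def]
          del: mult_Suc mult_Suc_right of_nat_Suc power_Suc flip: power_mult)
  show "fact (2 * s) * V_ser (2 * s+1) P z =
      (\<Sum>r=0..s. of_real (cfact_t (2 * s+1) (2*r+1)) / 2 ^ (2*r) * lambert 2 P alt_weight (2*r) odd_weight z)"
    unfolding V_ser_def
    by (rule lambert_eq_suminf[OF assms _ _ _ has_sum_cfact_odd])
       (simp_all add: weightD weight_values mult_ac nat_mult_1[unfolded One_nat_def]
          del: mult_Suc mult_Suc_right of_nat_Suc power_Suc flip: power_mult)
  show "fact (2 * s) * (-1) ^ s * VI_ser (2 * s+1) P z =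
      (\<Sum>r=0..s. of_real (cfact_t (2 * s+1) (2*r+1)) / 2 ^ (2*r) * lambert 2 P alt_weight (2*r) chi_weight z)"
    unfolding VI_ser_def
    by (rule lambert_eq_suminf[OF assms _ _ _ has_sum_cfact_odd_chi])
       (simp_all add: weightD weight_values mult_ac nat_mult_1[unfolded One_nat_def]
          del: mult_Suc mult_Suc_right of_nat_Suc power_Suc flip: power_mult)
  show "fact (2 * s) * VII_ser (2 * s+1) P z =
      (\<Sum>r=0..s. of_real (cfact_t (2 * s+1) (2*r+1)) / 2 ^ (2*r) * lambert 1 P chi_weight (2*r) odd_weight z)"
    unfolding VII_ser_def
    by (rule lambert_eq_suminf_odd[OF assms _ _ _ has_sum_cfact_odd])
       (simp_all add: weightD weight_values mult_ac nat_mult_1[unfolded One_nat_def]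
          del: mult_Suc mult_Suc_right of_nat_Suc power_Suc flip: power_mult)
  show "fact (2 * s) * (-1) ^ s * VIII_ser (2 * s+1) P z =
      (\<Sum>r=0..s. of_real (cfact_t (2 * s+1) (2*r+1)) / 2 ^ (2*r) * lambert 1 P chi_weight (2*r) chi_weight z)"
    unfolding VIII_ser_def
    by (rule lambert_eq_suminf_odd[OF assms _ _ _ has_sum_cfact_odd_chi])
       (simp_all add: weightD weight_values mult_ac nat_mult_1[unfolded One_nat_def]
          del: mult_Suc mult_Suc_right of_nat_Suc power_Suc flip: power_mult)
qed

section \<open>Lowering the exponents\<close>

text \<open>Lowering both exponents by the smaller one, \<open>e\<close>, frees k of its power and
  leaves a member of the family.\<close>

lemma lambert_eq_Dop_left:
  assumes "lambert_family c \<alpha> \<beta> X" "1 \<le> c" "weight \<alpha>" "weight \<beta>" "norm z < 1" "e \<le> P"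
  shows "lambert c P \<alpha> e \<beta> z = (2 / of_nat c) ^ e * (Dop ^^ e) (X (P - e)) z"
proof -
  have "(Dop ^^ e) (X (P - e)) z = (of_nat c / 2) ^ e * lambert c (P - e + e) \<alpha> (0 + e) \<beta> z"
    using assms(1) by (intro funpow_Dop_lambert assms(2,5) weightD assms(3,4)) (simp add: lambert_family_def)
  then show ?thesis
    using assms(2,6) by (simp add: power_divide)
qed

lemma lambert_eq_Dop_right:
  assumes "lambert_family c \<beta> \<alpha> Y" "1 \<le> c" "weight \<alpha>" "weight \<beta>" "norm z < 1" "P \<le> e"
  shows "lambert c P \<alpha> e \<beta> z = (2 / of_nat c) ^ P * (Dop ^^ P) (Y (e - P)) z"
  using lambert_eq_Dop_left[OF assms(1,2,4,3,5,6)] by (subst lambert_swap)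

text \<open>The cut \<open>q\<close> may lie beyond s + 1; the second sum is then empty and the
  surplus terms of the first vanish.\<close>

lemma sum_cfact_split:
  fixes f :: "nat \<Rightarrow> complex"
  assumes "\<And>r. s < r \<Longrightarrow> f r = 0" "a \<le> q"
  shows "(\<Sum>r=a..s. f r) = (\<Sum>r=a..<q. f r) + (\<Sum>r=q..s. f r)"
proof (cases "q \<le> Suc s")
  case True
  have "{a..s} = {a..<Suc s}" "{q..s} = {q..<Suc s}" by auto
  then show ?thesis
    using sum.atLeastLessThan_concat[OF assms(2) True, of f] by simp
next
  case False
  then have "(\<Sum>r=a..<q. f r) = (\<Sum>r=a..s. f r)"
    using assms by (intro sum.mono_neutral_right) auto
  then show ?thesis using False by simp
qed

text \<open>The cut at p serves both parities of \<open>P\<close>: r <= p gives 2r - 1 <= P, and r >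
  p gives P <= 2r - 1. For c = 2 the factor 2/c disappears.\<close>

lemma sum_cfact_even_Dop:
  assumes "lambert_family 2 \<alpha> \<beta> X" "lambert_family 2 \<beta> \<alpha> Y" "weight \<alpha>" "weight \<beta>"
    and "1 \<le> s" "norm z < 1" "P = 2*p \<or> P = 2*p+1"
  shows "(\<Sum>r=1..s. of_real (cfact_t (2 * s) (2*r)) * lambert 2 P \<alpha> (2*r-1) \<beta> z) =
     (\<Sum>r=1..p. of_real (cfact_t (2 * s) (2*r)) * (Dop ^^ (2*r-1)) (X (P-2*r+1)) z)
   + (\<Sum>r=p+1..s. of_real (cfact_t (2 * s) (2*r)) * (Dop ^^ P) (Y (2*r-P-1)) z)"
proof -
  have "(\<Sum>r=1..s. of_real (cfact_t (2 * s) (2*r)) * lambert 2 P \<alpha> (2*r-1) \<beta> z) =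
     (\<Sum>r=1..<p+1. of_real (cfact_t (2 * s) (2*r)) * lambert 2 P \<alpha> (2*r-1) \<beta> z)
   + (\<Sum>r=p+1..s. of_real (cfact_t (2 * s) (2*r)) * lambert 2 P \<alpha> (2*r-1) \<beta> z)"
    using assms(5) by (intro sum_cfact_split) (auto simp: cfact_t_even_eq_0)
  also have "(\<Sum>r=1..<p+1. of_real (cfact_t (2 * s) (2*r)) * lambert 2 P \<alpha> (2*r-1) \<beta> z) =
     (\<Sum>r=1..p. of_real (cfact_t (2 * s) (2*r)) * (Dop ^^ (2*r-1)) (X (P-2*r+1)) z)"
  proof (rule sum.cong)
    fix r assume r: "r \<in> {1..p}"
    then have "2*r-1 \<le> P" "P - (2*r-1) = P-2*r+1" using assms(7) by auto
    then show "of_real (cfact_t (2 * s) (2*r)) * lambert 2 P \<alpha> (2*r-1) \<beta> z =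
        of_real (cfact_t (2 * s) (2*r)) * (Dop ^^ (2*r-1)) (X (P-2*r+1)) z"
      using lambert_eq_Dop_left[OF assms(1) _ assms(3,4,6), of "2*r-1" P] by simp
  qed auto
  also have "(\<Sum>r=p+1..s. of_real (cfact_t (2 * s) (2*r)) * lambert 2 P \<alpha> (2*r-1) \<beta> z) =
     (\<Sum>r=p+1..s. of_real (cfact_t (2 * s) (2*r)) * (Dop ^^ P) (Y (2*r-P-1)) z)"
  proof (rule sum.cong)
    fix r assume r: "r \<in> {p+1..s}"
    then have "P \<le> 2*r-1" "2*r-1-P = 2*r-P-1" using assms(7) by auto
    then show "of_real (cfact_t (2 * s) (2*r)) * lambert 2 P \<alpha> (2*r-1) \<beta> z =
        of_real (cfact_t (2 * s) (2*r)) * (Dop ^^ P) (Y (2*r-P-1)) z"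
      using lambert_eq_Dop_right[OF assms(2) _ assms(3,4,6), of P "2*r-1"] by simp
  qed simp
  finally show ?thesis .
qed

lemma sum_cfact_odd_Dop:
  assumes "lambert_family c \<alpha> \<beta> X" "lambert_family c \<beta> \<alpha> Y" "1 \<le> c" "weight \<alpha>" "weight \<beta>"
    and "norm z < 1" "\<And>r. r < q \<Longrightarrow> 2*r \<le> P" "\<And>r. q \<le> r \<Longrightarrow> P \<le> 2*r"
  shows "(\<Sum>r=0..s. of_real (cfact_t (2 * s+1) (2*r+1)) / 2 ^ (2*r) * lambert c P \<alpha> (2*r) \<beta> z) =
     (\<Sum>r<q. of_real (cfact_t (2 * s+1) (2*r+1)) / 2 ^ (2*r) * ((2 / of_nat c) ^ (2*r) * (Dop ^^ (2*r)) (X (P-2*r)) z))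
   + (\<Sum>r=q..s. of_real (cfact_t (2 * s+1) (2*r+1)) / 2 ^ (2*r) * ((2 / of_nat c) ^ P * (Dop ^^ P) (Y (2*r-P)) z))"
proof -
  let ?f = "\<lambda>r. of_real (cfact_t (2 * s+1) (2*r+1)) / 2 ^ (2*r) * lambert c P \<alpha> (2*r) \<beta> z"
  have "(\<Sum>r=0..s. ?f r) = (\<Sum>r=0..<q. ?f r) + (\<Sum>r=q..s. ?f r)"
    using cfact_t_odd_eq_0[of s] by (intro sum_cfact_split) auto
  also have "(\<Sum>r=0..<q. ?f r) = (\<Sum>r<q. of_real (cfact_t (2 * s+1) (2*r+1)) / 2 ^ (2*r) *
      ((2 / of_nat c) ^ (2*r) * (Dop ^^ (2*r)) (X (P-2*r)) z))"
    unfolding atLeast0LessThan using assms(7)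
    by (intro sum.cong refl arg_cong2[where f="(*)"] lambert_eq_Dop_left[OF assms(1,3-6)]) auto
  also have "(\<Sum>r=q..s. ?f r) = (\<Sum>r=q..s. of_real (cfact_t (2 * s+1) (2*r+1)) / 2 ^ (2*r) *
      ((2 / of_nat c) ^ P * (Dop ^^ P) (Y (2*r-P)) z))"
    using assms(8)
    by (intro sum.cong refl arg_cong2[where f="(*)"] lambert_eq_Dop_right[OF assms(2-6)]) auto
  finally show ?thesis .
qed

lemma sum_cfact_even_Dop_odd_power:
  assumes "lambert_family 2 \<alpha> \<beta> X" "lambert_family 2 \<beta> \<alpha> Y" "weight \<alpha>" "weight \<beta>"
    and "1 \<le> s" "norm z < 1"
  shows "(\<Sum>r=1..s. of_real (cfact_t (2 * s) (2*r)) * lambert 2 (2*p+1) \<alpha> (2*r-1) \<beta> z) =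
     (\<Sum>r=1..p. of_real (cfact_t (2 * s) (2*r)) * (Dop ^^ (2*r-1)) (X (2*p-2*r+2)) z)
   + (\<Sum>r=p+1..s. of_real (cfact_t (2 * s) (2*r)) * (Dop ^^ (2*p+1)) (Y (2*r-2*p-2)) z)"
proof -
  have "(2*p+1)-2*r+1 = 2*p-2*r+2" if "r \<in> {1..p}" for r
    using that by auto
  moreover have "2*r-(2*p+1)-1 = 2*r-2*p-2" for r
    by simp
  ultimately show ?thesis
    using sum_cfact_even_Dop[OF assms, of "2*p+1" p] by (simp only: simp_thms cong: sum.cong)
qed

text \<open>D is normalised for c = 2, so the case c = 4 is evaluated at z^2: D is applied first and
  q is replaced by q^2 afterwards.\<close>

lemma sum_cfact_even_Dop_square:
  assumes "lambert_family 2 \<alpha> \<beta> X" "lambert_family 2 \<beta> \<alpha> Y" "weight \<alpha>" "weight \<beta>"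
    and "1 \<le> s" "norm z < 1"
  shows "(\<Sum>r=1..s. of_real (cfact_t (2 * s) (2*r)) * lambert 4 (2*p) \<alpha> (2*r-1) \<beta> z) =
     (\<Sum>r=1..p. of_real (cfact_t (2 * s) (2*r)) * (Dop ^^ (2*r-1)) (X (2*p-2*r+1)) (z^2))
   + (\<Sum>r=p+1..s. of_real (cfact_t (2 * s) (2*r)) * (Dop ^^ (2*p)) (Y (2*r-2*p-1)) (z^2))"
proof -
  have "norm (z^2) < 1"
    using assms(6) by (simp add: norm_power power_less_one_iff)
  moreover have "lambert 4 i \<alpha> j \<beta> z = lambert 2 i \<alpha> j \<beta> (z^2)" for i j
    using lambert_power[of 2 2 i \<alpha> j \<beta> z] by simp
  ultimately show ?thesis
    using sum_cfact_even_Dop[OF assms(1-5), of "z^2" "2*p" p] by simp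
qed

lemma sum_reindex_odd_diff:
  fixes f :: "nat \<Rightarrow> nat \<Rightarrow> complex"
  shows "(\<Sum>r<p+1. f r (2*p+1-2*r)) = (\<Sum>r=0..p. f r (2*p-2*r+1))"
  by (rule sum.cong) (auto simp: Suc_diff_le)

lemma sum_cfact_odd_Dop_integral:
  assumes "lambert_family 2 \<alpha> \<beta> X" "lambert_family 2 \<beta> \<alpha> Y" "weight \<alpha>" "weight \<beta>" "norm z < 1"
  shows "(\<Sum>r=0..s. of_real (cfact_t (2 * s+1) (2*r+1)) / 2^(2*r) * lambert 2 (2*p) \<alpha> (2*r) \<beta> z) =
     (\<Sum>r<p. of_real (cfact_t (2 * s+1) (2*r+1)) / 2^(2*r) * (Dop ^^ (2*r)) (X (2*p-2*r)) z)
   + (\<Sum>r=p..s. of_real (cfact_t (2 * s+1) (2*r+1)) / 2^(2*r) * (Dop ^^ (2*p)) (Y (2*r-2*p)) z)"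
    and "(\<Sum>r=0..s. of_real (cfact_t (2 * s+1) (2*r+1)) / 2^(2*r) * lambert 2 (2*p+1) \<alpha> (2*r) \<beta> z) =
     (\<Sum>r=0..p. of_real (cfact_t (2 * s+1) (2*r+1)) / 2^(2*r) * (Dop ^^ (2*r)) (X (2*p-2*r+1)) z)
   + (\<Sum>r=p+1..s. of_real (cfact_t (2 * s+1) (2*r+1)) / 2^(2*r) * (Dop ^^ (2*p+1)) (Y (2*r-2*p-1)) z)"
proof -
  note split = sum_cfact_odd_Dop[OF assms(1,2) _ assms(3-5), where s=s]
  show "(\<Sum>r=0..s. of_real (cfact_t (2 * s+1) (2*r+1)) / 2^(2*r) * lambert 2 (2*p) \<alpha> (2*r) \<beta> z) =
     (\<Sum>r<p. of_real (cfact_t (2 * s+1) (2*r+1)) / 2^(2*r) * (Dop ^^ (2*r)) (X (2*p-2*r)) z)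
   + (\<Sum>r=p..s. of_real (cfact_t (2 * s+1) (2*r+1)) / 2^(2*r) * (Dop ^^ (2*p)) (Y (2*r-2*p)) z)"
    using split[of p "2*p"] by simp
  show "(\<Sum>r=0..s. of_real (cfact_t (2 * s+1) (2*r+1)) / 2^(2*r) * lambert 2 (2*p+1) \<alpha> (2*r) \<beta> z) =
     (\<Sum>r=0..p. of_real (cfact_t (2 * s+1) (2*r+1)) / 2^(2*r) * (Dop ^^ (2*r)) (X (2*p-2*r+1)) z)
   + (\<Sum>r=p+1..s. of_real (cfact_t (2 * s+1) (2*r+1)) / 2^(2*r) * (Dop ^^ (2*p+1)) (Y (2*r-2*p-1)) z)"
    using split[of "p+1" "2*p+1",
      unfolded sum_reindex_odd_diff[where f="\<lambda>r e. of_real (cfact_t (2 * s+1) (2*r+1)) / 2 ^ (2*r) * ((2 / of_nat 2) ^ (2*r) * (Dop ^^ (2*r)) (X e) z)"]]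
    by simp
qed

text \<open>For c = 1 each D contributes a factor 2. In the first sum these cancel 2^(-2r); in the
  second they leave 2^P / 2^(2r), where P is the power of n.\<close>

lemma sum_cfact_odd_Dop_half:
  assumes "lambert_family 1 \<alpha> \<beta> X" "lambert_family 1 \<beta> \<alpha> Y" "weight \<alpha>" "weight \<beta>" "norm z < 1"
  shows "(\<Sum>r=0..s. of_real (cfact_t (2 * s+1) (2*r+1)) / 2^(2*r) * lambert 1 (2*p) \<alpha> (2*r) \<beta> z) =
     (\<Sum>r<p. of_real (cfact_t (2 * s+1) (2*r+1)) * (Dop ^^ (2*r)) (X (2*p-2*r)) z)
   + (\<Sum>r=p..s. 2^(2*p) / 2^(2*r) * of_real (cfact_t (2 * s+1) (2*r+1)) * (Dop ^^ (2*p)) (Y (2*r-2*p)) z)"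
    and "(\<Sum>r=0..s. of_real (cfact_t (2 * s+1) (2*r+1)) / 2^(2*r) * lambert 1 (2*p+1) \<alpha> (2*r) \<beta> z) =
     (\<Sum>r=0..p. of_real (cfact_t (2 * s+1) (2*r+1)) * (Dop ^^ (2*r)) (X (2*p-2*r+1)) z)
   + (\<Sum>r=p+1..s. 2^(2*p+1) / 2^(2*r) * of_real (cfact_t (2 * s+1) (2*r+1)) * (Dop ^^ (2*p+1)) (Y (2*r-2*p-1)) z)"
proof -
  note split = sum_cfact_odd_Dop[OF assms(1,2) _ assms(3-5), where s=s]
  show "(\<Sum>r=0..s. of_real (cfact_t (2 * s+1) (2*r+1)) / 2^(2*r) * lambert 1 (2*p) \<alpha> (2*r) \<beta> z) =
     (\<Sum>r<p. of_real (cfact_t (2 * s+1) (2*r+1)) * (Dop ^^ (2*r)) (X (2*p-2*r)) z)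
   + (\<Sum>r=p..s. 2^(2*p) / 2^(2*r) * of_real (cfact_t (2 * s+1) (2*r+1)) * (Dop ^^ (2*p)) (Y (2*r-2*p)) z)"
    using split[of p "2*p"] by (simp add: mult_ac)
  show "(\<Sum>r=0..s. of_real (cfact_t (2 * s+1) (2*r+1)) / 2^(2*r) * lambert 1 (2*p+1) \<alpha> (2*r) \<beta> z) =
     (\<Sum>r=0..p. of_real (cfact_t (2 * s+1) (2*r+1)) * (Dop ^^ (2*r)) (X (2*p-2*r+1)) z)
   + (\<Sum>r=p+1..s. 2^(2*p+1) / 2^(2*r) * of_real (cfact_t (2 * s+1) (2*r+1)) * (Dop ^^ (2*p+1)) (Y (2*r-2*p-1)) z)"
    using split[of "p+1" "2*p+1",
      unfolded sum_reindex_odd_diff[where f="\<lambda>r e. of_real (cfact_t (2 * s+1) (2*r+1)) / 2 ^ (2*r) * ((2 / of_nat 1) ^ (2*r) * (Dop ^^ (2*r)) (X e) z)"]]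
    by (simp add: mult_ac)
qed

theorem theorem3p2:
  fixes s p :: nat and z :: complex
  assumes hs: "1 \<le> s" and hz0: "0 < norm z" and hz1: "norm z < 1"
  shows
  "fact (2* s-1) * I_ser (2* s) (2*p) z =
     (\<Sum>r=1..p. of_real (cfact_t (2* s) (2*r)) * (Dop ^^ (2*r-1)) (A_ser (2*p-2*r+1)) (z^2))
   + (\<Sum>r=p+1..s. of_real (cfact_t (2* s) (2*r)) * (Dop ^^ (2*p)) (A_ser (2*r-2*p-1)) (z^2))
 \<and> fact (2* s) * I_ser (2* s+1) (2*p+1) z =
     (\<Sum>r=0..p. of_real (cfact_t (2* s+1) (2*r+1)) / 2^(2*r) * (Dop ^^ (2*r)) (C_ser (2*p-2*r+1)) z)
   + (\<Sum>r=p+1..s. of_real (cfact_t (2* s+1) (2*r+1)) / 2^(2*r) * (Dop ^^ (2*p+1)) (F_ser (2*r-2*p-1)) z)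
 \<and> fact (2* s-1) * (-1)^(s-1) * II_ser (2* s) (2*p) z =
     (\<Sum>r=1..p. of_real (cfact_t (2* s) (2*r)) * (Dop ^^ (2*r-1)) (L_ser (2*p-2*r+1)) (z^2))
   + (\<Sum>r=p+1..s. of_real (cfact_t (2* s) (2*r)) * (Dop ^^ (2*p)) (B_ser (2*r-2*p-1)) (z^2))
 \<and> fact (2* s) * (-1)^s * II_ser (2* s+1) (2*p) z =
     (\<Sum>r<p. of_real (cfact_t (2* s+1) (2*r+1)) / 2^(2*r) * (Dop ^^ (2*r)) (N_ser (2*p-2*r)) z)
   + (\<Sum>r=p..s. of_real (cfact_t (2* s+1) (2*r+1)) / 2^(2*r) * (Dop ^^ (2*p)) (G_ser (2*r-2*p)) z)
 \<and> fact (2* s-1) * III_ser (2* s) (2*p) z =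
     (\<Sum>r=1..p. of_real (cfact_t (2* s) (2*r)) * (Dop ^^ (2*r-1)) (F_ser (2*p-2*r+1)) z)
   + (\<Sum>r=p+1..s. of_real (cfact_t (2* s) (2*r)) * (Dop ^^ (2*p)) (C_ser (2*r-2*p-1)) z)
 \<and> fact (2* s) * III_ser (2* s+1) (2*p+1) z =
     (\<Sum>r=0..p. of_real (cfact_t (2* s+1) (2*r+1)) * (Dop ^^ (2*r)) (H_ser (2*p-2*r+1)) z)
   + (\<Sum>r=p+1..s. 2^(2*p+1) / 2^(2*r) * of_real (cfact_t (2* s+1) (2*r+1)) * (Dop ^^ (2*p+1)) (H_ser (2*r-2*p-1)) z)
 \<and> fact (2* s-1) * (-1)^(s-1) * IV_ser (2* s) (2*p) z =
     (\<Sum>r=1..p. of_real (cfact_t (2* s) (2*r)) * (Dop ^^ (2*r-1)) (Q_ser (2*p-2*r+1)) z)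
   + (\<Sum>r=p+1..s. of_real (cfact_t (2* s) (2*r)) * (Dop ^^ (2*p)) (D_ser (2*r-2*p-1)) z)
 \<and> fact (2* s) * (-1)^s * IV_ser (2* s+1) (2*p) z =
     (\<Sum>r<p. of_real (cfact_t (2* s+1) (2*r+1)) * (Dop ^^ (2*r)) (T_ser (2*p-2*r)) z)
   + (\<Sum>r=p..s. 2^(2*p) / 2^(2*r) * of_real (cfact_t (2* s+1) (2*r+1)) * (Dop ^^ (2*p)) (J_ser (2*r-2*p)) z)
 \<and> fact (2* s-1) * V_ser (2* s) (2*p) z =
     (\<Sum>r=1..p. of_real (cfact_t (2* s) (2*r)) * (Dop ^^ (2*r-1)) (B_ser (2*p-2*r+1)) (z^2))
   + (\<Sum>r=p+1..s. of_real (cfact_t (2* s) (2*r)) * (Dop ^^ (2*p)) (L_ser (2*r-2*p-1)) (z^2))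
 \<and> fact (2* s) * V_ser (2* s+1) (2*p+1) z =
     (\<Sum>r=0..p. of_real (cfact_t (2* s+1) (2*r+1)) / 2^(2*r) * (Dop ^^ (2*r)) (D_ser (2*p-2*r+1)) z)
   + (\<Sum>r=p+1..s. of_real (cfact_t (2* s+1) (2*r+1)) / 2^(2*r) * (Dop ^^ (2*p+1)) (Q_ser (2*r-2*p-1)) z)
 \<and> fact (2* s-1) * (-1)^(s-1) * VI_ser (2* s) (2*p) z =
     (\<Sum>r=1..p. of_real (cfact_t (2* s) (2*r)) * (Dop ^^ (2*r-1)) (M_ser (2*p-2*r+1)) (z^2))
   + (\<Sum>r=p+1..s. of_real (cfact_t (2* s) (2*r)) * (Dop ^^ (2*p)) (M_ser (2*r-2*p-1)) (z^2))
 \<and> fact (2* s) * (-1)^s * VI_ser (2* s+1) (2*p) z =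
     (\<Sum>r<p. of_real (cfact_t (2* s+1) (2*r+1)) / 2^(2*r) * (Dop ^^ (2*r)) (P_ser (2*p-2*r)) z)
   + (\<Sum>r=p..s. of_real (cfact_t (2* s+1) (2*r+1)) / 2^(2*r) * (Dop ^^ (2*p)) (R_ser (2*r-2*p)) z)
 \<and> fact (2* s-1) * VII_ser (2* s) (2*p+1) z =
     (\<Sum>r=1..p. of_real (cfact_t (2* s) (2*r)) * (Dop ^^ (2*r-1)) (G_ser (2*p-2*r+2)) z)
   + (\<Sum>r=p+1..s. of_real (cfact_t (2* s) (2*r)) * (Dop ^^ (2*p+1)) (N_ser (2*r-2*p-2)) z)
 \<and> fact (2* s) * VII_ser (2* s+1) (2*p) z =
     (\<Sum>r<p. of_real (cfact_t (2* s+1) (2*r+1)) * (Dop ^^ (2*r)) (J_ser (2*p-2*r)) z)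
   + (\<Sum>r=p..s. 2^(2*p) / 2^(2*r) * of_real (cfact_t (2* s+1) (2*r+1)) * (Dop ^^ (2*p)) (T_ser (2*r-2*p)) z)
 \<and> fact (2* s-1) * (-1)^(s-1) * VIII_ser (2* s) (2*p+1) z =
     (\<Sum>r=1..p. of_real (cfact_t (2* s) (2*r)) * (Dop ^^ (2*r-1)) (R_ser (2*p-2*r+2)) z)
   + (\<Sum>r=p+1..s. of_real (cfact_t (2* s) (2*r)) * (Dop ^^ (2*p+1)) (P_ser (2*r-2*p-2)) z)
 \<and> fact (2* s) * (-1)^s * VIII_ser (2* s+1) (2*p+1) z =
     (\<Sum>r=0..p. of_real (cfact_t (2* s+1) (2*r+1)) * (Dop ^^ (2*r)) (U_ser (2*p-2*r+1)) z)
   + (\<Sum>r=p+1..s. 2^(2*p+1) / 2^(2*r) * of_real (cfact_t (2* s+1) (2*r+1)) * (Dop ^^ (2*p+1)) (U_ser (2*r-2*p-1)) z)"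
proof (intro conjI, goal_cases)
  \<comment> \<open>In every case the two series on the right carry the same pair of weights in
    opposite order, since the second sum arises by exchanging n and k. The families A, H, M and U
    have equal weights and so occur in both sums.\<close>
  case 1
  show ?case
    unfolding even_series_eq_lambert(1)[OF hs hz1]
    by (rule sum_cfact_even_Dop_square[OF lambert_families(1,1) weights(1,1) hs hz1])
next
  case 2
  show ?case
    unfolding odd_series_eq_lambert(1)[OF hz1]
    by (rule sum_cfact_odd_Dop_integral(2)[OF lambert_families(3,5) weights(1,3) hz1])
next
  case 3
  show ?case
    unfolding even_series_eq_lambert(2)[OF hs hz1]
    by (rule sum_cfact_even_Dop_square[OF lambert_families(9,2) weights(1,2) hs hz1])
next
  case 4
  show ?case
    unfolding odd_series_eq_lambert(2)[OF hz1]
    by (rule sum_cfact_odd_Dop_integral(1)[OF lambert_families(11,6) weights(1,4) hz1])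
next
  case 5
  show ?case
    unfolding even_series_eq_lambert(3)[OF hs hz1]
    by (rule sum_cfact_even_Dop[OF lambert_families(5,3) weights(3,1) hs hz1 disjI1[OF refl]])
next
  case 6
  show ?case
    unfolding odd_series_eq_lambert(3)[OF hz1]
    by (rule sum_cfact_odd_Dop_half(2)[OF lambert_families(7,7) weights(3,3) hz1])
next
  case 7
  show ?case
    unfolding even_series_eq_lambert(4)[OF hs hz1]
    by (rule sum_cfact_even_Dop[OF lambert_families(13,4) weights(3,2) hs hz1 disjI1[OF refl]])
next
  case 8
  show ?case
    unfolding odd_series_eq_lambert(4)[OF hz1]
    by (rule sum_cfact_odd_Dop_half(1)[OF lambert_families(15,8) weights(3,4) hz1])
next
  case 9
  show ?case
    unfolding even_series_eq_lambert(5)[OF hs hz1]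
    by (rule sum_cfact_even_Dop_square[OF lambert_families(2,9) weights(2,1) hs hz1])
next
  case 10
  show ?case
    unfolding odd_series_eq_lambert(5)[OF hz1]
    by (rule sum_cfact_odd_Dop_integral(2)[OF lambert_families(4,13) weights(2,3) hz1])
next
  case 11
  show ?case
    unfolding even_series_eq_lambert(6)[OF hs hz1]
    by (rule sum_cfact_even_Dop_square[OF lambert_families(10,10) weights(2,2) hs hz1])
next
  case 12
  show ?case
    unfolding odd_series_eq_lambert(6)[OF hz1]
    by (rule sum_cfact_odd_Dop_integral(1)[OF lambert_families(12,14) weights(2,4) hz1])
next
  case 13
  show ?case
    unfolding even_series_eq_lambert(7)[OF hs hz1]
    by (rule sum_cfact_even_Dop_odd_power[OF lambert_families(6,11) weights(4,1) hs hz1])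
next
  case 14
  show ?case
    unfolding odd_series_eq_lambert(7)[OF hz1]
    by (rule sum_cfact_odd_Dop_half(1)[OF lambert_families(8,15) weights(4,3) hz1])
next
  case 15
  show ?case
    unfolding even_series_eq_lambert(8)[OF hs hz1]
    by (rule sum_cfact_even_Dop_odd_power[OF lambert_families(14,12) weights(4,2) hs hz1])
next
  case 16
  show ?case
    unfolding odd_series_eq_lambert(8)[OF hz1]
    by (rule sum_cfact_odd_Dop_half(2)[OF lambert_families(16,16) weights(4,4) hz1])
qed

end
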